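(* Let $\mathcal P(\{S_{i,s}\})$ be the algebra of all polynomials in the operators $S_{i,s}$, $i\in\{1,\dots,k\}$, $s\in\{1,\dots,n_i\}$, and the identity. Then the noncommutative Hardy space $F^\infty(\mathbf B_\Lambda)$ is WOT-closed (resp. SOT-closed, w*-closed) in $B(\ell^2(\mathbf F))$ and $$F^\infty(\mathbf B_\Lambda)=\overline{\mathcal P(\{S_{i,s}\})}^{\,\mathrm{SOT}}=\overline{\mathcal P(\{S_{i,s}\})}^{\,\mathrm{WOT}}=\overline{\mathcal P(\{S_{i,s}\})}^{\,\mathrm{w}^*}.$$ Moreover, $F^\infty(\mathbf B_\Lambda)$ is the sequential SOT- (resp. WOT-, w*-) closure of $\mathcal P(\{S_{i,s}\})$.
   Context: Let $k,n_1,\dots,n_k$ be positive integers. For $i,j\in\{1,\dots,k\}$, $i\ne j$, let $\Lambda_{ij}=[\lambda_{i,j}(s,t)]$ be an $n_i\times n_j$ matrix with entries in $\mathbb T=\{z\in\mathbb C:|z|=1\}$, with $\Lambda_{ji}=\Lambda_{ij}^*$, i.e. $\lambda_{j,i}(t,s)=\overline{\lambda_{i,j}(s,t)}$. Words: $\mathbb F_{n_i}^+$ is the unital free semigroup with generators $g^i_1,\dots,g^i_{n_i}$ and neutral element $g^i_0$. If $X_{i,1},\dots,X_{i,n_i}$ are operators and $\alpha=g^i_{p_1}\cdots g^i_{p_m}$, put $X_{i,\alpha}=X_{i,p_1}\cdots X_{i,p_m}$, and $X_{i,g^i_0}=I$. Set $\mathbf F=\mathbb F_{n_1}^+\times\cdots\times\mathbb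 F_{n_k}^+$. Universal model: on $\ell^2(\mathbf F)$ with orthonormal basis $\{\chi_{(\alpha_1,\dots,\alpha_k)}\}$, $$S_{i,s}\chi_{(\alpha_1,\dots,\alpha_k)}=\boldsymbol\lambda_{i,1}(s,\alpha_1)\cdots\boldsymbol\lambda_{i,i-1}(s,\alpha_{i-1})\,\chi_{(\alpha_1,\dots,\alpha_{i-1},g^i_s\alpha_i,\alpha_{i+1},\dots,\alpha_k)}$$ (no scalar factor if $i=1$), where $\boldsymbol\lambda_{i,j}(s,\beta)=\prod_{b=1}^q\lambda_{i,j}(s,j_b)$ for $\beta=g^j_{j_1}\cdots g^j_{j_q}$ and $\boldsymbol\lambda_{i,j}(s,g^j_0)=1$. For $\boldsymbol\beta=(\beta_1,\dots,\beta_k)\in\mathbf F$ put $\mathbf S_{\boldsymbol\beta}=S_{1,\beta_1}\cdots S_{k,\beta_k}$. Noncommutative Hardy space: let $\{c_{\boldsymbol\beta}\}_{\boldsymbol\beta\in\mathbf F}\subset\mathbb C$ with $\sum|c_{\boldsymbol\beta}|^2<\infty$, and consider the formal series $\varphi(\{S_{i,s}\})=\sum_{\boldsymbol\beta}c_{\boldsymbol\beta}\mathbf S_{\boldsymbol\beta}$. For each $\boldsymbol\gamma\in\mathbf F$, $\varphi(\{S_{i,s}\})\chi_{\boldsymbol\gamma}:=\sum_{\boldsymbol\beta}c_{\boldsymbol\beta}\mathbf S_{\boldsymbol\beta}\chi_{\boldsymbol\gamma}$ is a vector of $\ell^2(\mathbf F)$, so $\varphi(\{S_{i,s}\})p$ is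 defined by linearity for $p$ in $\mathcal P:=\mathrm{span}\{\chi_{\boldsymbol\gamma}\}$. If $\sup_{p\in\mathcal P,\|p\|\le1}\|\varphi(\{S_{i,s}\})p\|<\infty$, there is a unique $A\in B(\ell^2(\mathbf F))$ with $Ap=\varphi(\{S_{i,s}\})p$ for all $p\in\mathcal P$. $F^\infty(\mathbf B_\Lambda)$ is the set of all operators $A$ obtained this way, and $\varphi(\{S_{i,s}\})$ is called the formal Fourier series (representation) of $A$. SOT, WOT, w* denote the strong operator, weak operator and weak-* topologies on $B(\ell^2(\mathbf F))$. *)

theory Defs
  imports "HOL-Analysis.Analysis"
begin

text \<open>
  Since the index set of the Hilbert space depends on natural-number parameters, the space is a set
  of functions: the families supported in \<open>X\<close> that are square-summable.
\<close>

definition ell2 :: "'a set \<Rightarrow> ('a \<Rightarrow> complex) set" where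
  "ell2 X = {f. (\<forall>x. x \<notin> X \<longrightarrow> f x = 0) \<and> (\<lambda>x. (cmod (f x))\<^sup>2) summable_on X}"

definition ell2_inner :: "'a set \<Rightarrow> ('a \<Rightarrow> complex) \<Rightarrow> ('a \<Rightarrow> complex) \<Rightarrow> complex" where
  "ell2_inner X f g = (\<Sum>\<^sub>\<infinity>x\<in>X. f x * cnj (g x))"

definition ell2_norm :: "'a set \<Rightarrow> ('a \<Rightarrow> complex) \<Rightarrow> real" where
  "ell2_norm X f = sqrt (\<Sum>\<^sub>\<infinity>x\<in>X. (cmod (f x))\<^sup>2)"

definition chi :: "'a \<Rightarrow> 'a \<Rightarrow> complex" where
  "chi x = indicator {x}"

definition ell2_span :: "'a set \<Rightarrow> ('a \<Rightarrow> complex) set" where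
  "ell2_span X = {p. finite {x. p x \<noteq> 0} \<and> {x. p x \<noteq> 0} \<subseteq> X}"

text \<open>Convergence is in norm, along the net of finite partial sums.\<close>

definition ell2_has_sum ::
    "'a set \<Rightarrow> ('b \<Rightarrow> 'a \<Rightarrow> complex) \<Rightarrow> 'b set \<Rightarrow> ('a \<Rightarrow> complex) \<Rightarrow> bool" where
  "ell2_has_sum X g J v \<longleftrightarrow> v \<in> ell2 X \<and>
     ((\<lambda>E. ell2_norm X (\<lambda>x. (\<Sum>b\<in>E. g b x) - v x)) \<longlongrightarrow> 0) (finite_subsets_at_top J)"

definition ell2_sum :: "'a set \<Rightarrow> ('b \<Rightarrow> 'a \<Rightarrow> complex) \<Rightarrow> 'b set \<Rightarrow> 'a \<Rightarrow> complex" where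
  "ell2_sum X g J = (THE v. ell2_has_sum X g J v)"

type_synonym 'a oper = "('a \<Rightarrow> complex) \<Rightarrow> 'a \<Rightarrow> complex"

text \<open>
  Operators are extensional functions on \<open>ell2 X\<close>, so that equality of operators is equality
  in HOL; the product of operators is \<^const>\<open>compose\<close>.
\<close>

definition bops :: "'a set \<Rightarrow> 'a oper set" where
  "bops X = {T. T \<in> ell2 X \<rightarrow>\<^sub>E ell2 X \<and>
     (\<forall>f\<in>ell2 X. \<forall>g\<in>ell2 X. T (\<lambda>x. f x + g x) = (\<lambda>x. T f x + T g x)) \<and>
     (\<forall>c. \<forall>f\<in>ell2 X. T (\<lambda>x. c * f x) = (\<lambda>x. c * T f x)) \<and>
     (\<exists>M. \<forall>f\<in>ell2 X. ell2_norm X (T f) \<le> M * ell2_norm X f)}"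

definition op_id :: "'a set \<Rightarrow> 'a oper" where
  "op_id X = (\<lambda>f\<in>ell2 X. f)"

definition op_add :: "'a set \<Rightarrow> 'a oper \<Rightarrow> 'a oper \<Rightarrow> 'a oper" where
  "op_add X S T = (\<lambda>f\<in>ell2 X. \<lambda>x. S f x + T f x)"

definition op_scale :: "'a set \<Rightarrow> complex \<Rightarrow> 'a oper \<Rightarrow> 'a oper" where
  "op_scale X c T = (\<lambda>f\<in>ell2 X. \<lambda>x. c * T f x)"

abbreviation op_mult :: "'a set \<Rightarrow> 'a oper \<Rightarrow> 'a oper \<Rightarrow> 'a oper" where
  "op_mult X S T \<equiv> compose (ell2 X) S T"

inductive_set op_algebra :: "'a set \<Rightarrow> 'a oper set \<Rightarrow> 'a oper set"
  for X :: "'a set" and G :: "'a oper set" where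
    one: "op_id X \<in> op_algebra X G"
  | gen: "T \<in> G \<Longrightarrow> T \<in> op_algebra X G"
  | add: "S \<in> op_algebra X G \<Longrightarrow> T \<in> op_algebra X G \<Longrightarrow> op_add X S T \<in> op_algebra X G"
  | scale: "T \<in> op_algebra X G \<Longrightarrow> op_scale X c T \<in> op_algebra X G"
  | mult: "S \<in> op_algebra X G \<Longrightarrow> T \<in> op_algebra X G \<Longrightarrow> op_mult X S T \<in> op_algebra X G"

definition hilbert_schmidt :: "'a set \<Rightarrow> 'a oper set" where
  "hilbert_schmidt X = {T \<in> bops X. (\<lambda>x. (ell2_norm X (T (chi x)))\<^sup>2) summable_on X}"

text \<open>
  Products of two Hilbert--Schmidt operators, one of the textbook definitions of the trace class;
  it avoids the absolute value of an operator.
\<close>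

definition trace_class :: "'a set \<Rightarrow> 'a oper set" where
  "trace_class X = {op_mult X A B | A B. A \<in> hilbert_schmidt X \<and> B \<in> hilbert_schmidt X}"

definition op_trace :: "'a set \<Rightarrow> 'a oper \<Rightarrow> complex" where
  "op_trace X T = (\<Sum>\<^sub>\<infinity>x\<in>X. ell2_inner X (T (chi x)) (chi x))"

definition initial_topology :: "'b set \<Rightarrow> ('b \<Rightarrow> complex) set \<Rightarrow> 'b topology" where
  "initial_topology B \<Phi> =
     topology_generated_by {{A \<in> B. \<phi> A \<in> U} | \<phi> U. \<phi> \<in> \<Phi> \<and> open U}"

text \<open>The subbasic sets are the preimages of norm balls under the evaluations at \<open>f\<close>.\<close>

definition SOT :: "'a set \<Rightarrow> 'a oper topology" where
  "SOT X = topology_generated_by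
     {{A \<in> bops X. ell2_norm X (\<lambda>x. A f x - g x) < r} | f g r. f \<in> ell2 X \<and> g \<in> ell2 X \<and> r > 0}"

definition WOT :: "'a set \<Rightarrow> 'a oper topology" where
  "WOT X = initial_topology (bops X)
     {(\<lambda>A. ell2_inner X (A f) g) | f g. f \<in> ell2 X \<and> g \<in> ell2 X}"

text \<open>
  The space of bounded operators is the dual of the trace class, where \<open>A\<close> acts on the trace-class
  operator \<open>T\<close> as the trace of \<open>A T\<close>.
\<close>

definition weak_star :: "'a set \<Rightarrow> 'a oper topology" where
  "weak_star X = initial_topology (bops X)
     {(\<lambda>A. op_trace X (op_mult X A T)) | T. T \<in> trace_class X}"

definition sequential_closure_of :: "'b topology \<Rightarrow> 'b set \<Rightarrow> 'b set" where
  "sequential_closure_of \<tau> S =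
     {a. \<exists>\<sigma>. (\<forall>m. \<sigma> m \<in> S) \<and> limitin \<tau> \<sigma> a sequentially}"

text \<open>
  A word of the \<open>i\<close>-th free semigroup is a list over \<open>{1..n i}\<close> with the empty list as neutral
  element, and a tuple of words is a function that is the empty word outside \<open>{1..k}\<close>.
\<close>

type_synonym mword = "nat \<Rightarrow> nat list"

definition mwords :: "nat \<Rightarrow> (nat \<Rightarrow> nat) \<Rightarrow> mword set" where
  "mwords k n = {\<alpha>. (\<forall>i\<in>{1..k}. \<alpha> i \<in> lists {1..n i}) \<and> (\<forall>i. i \<notin> {1..k} \<longrightarrow> \<alpha> i = [])}"

text \<open>\<open>lam i j s t\<close> is the \<open>(s, t)\<close> entry of the matrix with index \<open>(i, j)\<close>.\<close>

type_synonym lam = "nat \<Rightarrow> nat \<Rightarrow> nat \<Rightarrow> nat \<Rightarrow> complex"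

definition word_lam :: "lam \<Rightarrow> nat \<Rightarrow> nat \<Rightarrow> nat \<Rightarrow> nat list \<Rightarrow> complex" where
  "word_lam lam i j s \<beta> = prod_list (map (lam i j s) \<beta>)"

definition shift_basis :: "lam \<Rightarrow> nat \<Rightarrow> nat \<Rightarrow> mword \<Rightarrow> mword \<Rightarrow> complex" where
  "shift_basis lam i s \<alpha> =
     (\<lambda>\<gamma>. (\<Prod>j\<in>{1..<i}. word_lam lam i j s (\<alpha> j)) * chi (\<alpha>(i := s # \<alpha> i)) \<gamma>)"

text \<open>
  The continuous linear extension; for fixed \<open>\<gamma>\<close> at most one term of the sum is nonzero.
\<close>

definition shift :: "nat \<Rightarrow> (nat \<Rightarrow> nat) \<Rightarrow> lam \<Rightarrow> nat \<Rightarrow> nat \<Rightarrow> mword oper" where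
  "shift k n lam i s =
     (\<lambda>f\<in>ell2 (mwords k n). \<lambda>\<gamma>. \<Sum>\<^sub>\<infinity>\<alpha>\<in>mwords k n. f \<alpha> * shift_basis lam i s \<alpha> \<gamma>)"

lemma chi_in_ell2: "x \<in> X \<Longrightarrow> chi x \<in> ell2 X"
proof -
  assume "x \<in> X"
  have "(\<lambda>y. (cmod (chi x y))\<^sup>2) summable_on {x}"
    by simp
  then have "(\<lambda>y. (cmod (chi x y))\<^sup>2) summable_on X"
    by (rule summable_on_cong_neutral[THEN iffD1, rotated -1])
      (use \<open>x \<in> X\<close> in \<open>auto simp: chi_def\<close>)
  then show ?thesis
    using \<open>x \<in> X\<close> by (auto simp: ell2_def chi_def indicator_def)
qed

lemma shift_chi:
  assumes "\<alpha> \<in> mwords k n"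
  shows "shift k n lam i s (chi \<alpha>) = shift_basis lam i s \<alpha>"
proof
  fix \<gamma>
  have "(\<Sum>\<^sub>\<infinity>\<beta>\<in>mwords k n. chi \<alpha> \<beta> * shift_basis lam i s \<beta> \<gamma>) =
        (\<Sum>\<^sub>\<infinity>\<beta>\<in>{\<alpha>}. chi \<alpha> \<beta> * shift_basis lam i s \<beta> \<gamma>)"
    by (rule infsum_cong_neutral) (use assms in \<open>auto simp: chi_def\<close>)
  then show "shift k n lam i s (chi \<alpha>) \<gamma> = shift_basis lam i s \<alpha> \<gamma>"
    using assms by (simp add: shift_def chi_in_ell2) (simp add: chi_def)
qed

definition shift_word :: "nat \<Rightarrow> (nat \<Rightarrow> nat) \<Rightarrow> lam \<Rightarrow> nat \<Rightarrow> nat list \<Rightarrow> mword oper" where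
  "shift_word k n lam i \<alpha> =
     foldr (\<lambda>s T. op_mult (mwords k n) (shift k n lam i s) T) \<alpha> (op_id (mwords k n))"

definition shift_mword :: "nat \<Rightarrow> (nat \<Rightarrow> nat) \<Rightarrow> lam \<Rightarrow> mword \<Rightarrow> mword oper" where
  "shift_mword k n lam \<beta> =
     foldr (\<lambda>i T. op_mult (mwords k n) (shift_word k n lam i (\<beta> i)) T) [1..<Suc k]
       (op_id (mwords k n))"

definition polynomials :: "nat \<Rightarrow> (nat \<Rightarrow> nat) \<Rightarrow> lam \<Rightarrow> mword oper set" where
  "polynomials k n lam =
     op_algebra (mwords k n) {shift k n lam i s | i s. i \<in> {1..k} \<and> s \<in> {1..n i}}"

definition series_chi ::
    "nat \<Rightarrow> (nat \<Rightarrow> nat) \<Rightarrow> lam \<Rightarrow> (mword \<Rightarrow> complex) \<Rightarrow> mword \<Rightarrow> mword \<Rightarrow> complex" where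
  "series_chi k n lam c \<gamma> =
     ell2_sum (mwords k n) (\<lambda>\<beta> \<delta>. c \<beta> * shift_mword k n lam \<beta> (chi \<gamma>) \<delta>) (mwords k n)"

definition series_apply ::
    "nat \<Rightarrow> (nat \<Rightarrow> nat) \<Rightarrow> lam \<Rightarrow> (mword \<Rightarrow> complex) \<Rightarrow> (mword \<Rightarrow> complex) \<Rightarrow> mword \<Rightarrow> complex" where
  "series_apply k n lam c p = (\<lambda>\<delta>. \<Sum>\<gamma> | p \<gamma> \<noteq> 0. p \<gamma> * series_chi k n lam c \<gamma> \<delta>)"

definition hardy :: "nat \<Rightarrow> (nat \<Rightarrow> nat) \<Rightarrow> lam \<Rightarrow> mword oper set" where
  "hardy k n lam = {A \<in> bops (mwords k n). \<exists>c\<in>ell2 (mwords k n).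
     bdd_above {ell2_norm (mwords k n) (series_apply k n lam c p) | p.
       p \<in> ell2_span (mwords k n) \<and> ell2_norm (mwords k n) p \<le> 1} \<and>
     (\<forall>p\<in>ell2_span (mwords k n). A p = series_apply k n lam c p)}"

end

theory Submission imports Defs
begin

text \<open>
  Write \<open>S\<^sub>\<beta> \<chi>\<^sub>\<gamma> = \<omega>(\<beta>,\<gamma>) \<chi>\<^sub>\<beta>\<^sub>\<gamma>\<close>; the phase \<open>\<omega>\<close> is multiplicative in both arguments. Hence the
  right shifts \<open>R\<^sub>\<gamma> \<chi>\<^sub>\<beta> = \<omega>(\<beta>,\<gamma>) \<chi>\<^sub>\<beta>\<^sub>\<gamma>\<close> commute with all \<open>S\<^sub>i\<^sub>,\<^sub>s\<close>, and the Hardy space consists of the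
  bounded operators \<open>A\<close> with \<open>A \<chi>\<^sub>\<gamma> = R\<^sub>\<gamma> (A \<chi>\<^sub>0)\<close> for all \<open>\<gamma>\<close>. These are linear equations between
  matrix entries of \<open>A\<close>, so they define a set that contains the polynomials and is closed in every
  topology for which the matrix entries are continuous.

  Conversely, \<open>A\<close> is approximated by the Fejer means of its Fourier series with respect to total word
  length. They are averages of block compressions \<open>P\<^sub>m A P\<^sub>m\<close>, which bounds their norms by the norm of
  \<open>A\<close>; as they converge on basis vectors, they converge strongly, hence weakly, and, being bounded,
  also weak-*: on a product of two Hilbert--Schmidt operators dominated convergence applies.
\<close>

section \<open>Square-summable families\<close>

text \<open>Truncating a Fourier series by length gives no uniform norm bound, already for a single
  shift (Fourier partial sums on the circle), while both the passage from basis vectors to all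
  vectors and the weak-* limit rest on such a bound. Hence the averaging. Its weights come from
  counting: a window is a set of \<open>N + 1\<close> consecutive lengths (fewer at the lower end),
  and the lengths \<open>l\<close> and \<open>l + d\<close> lie together in \<open>N + 1 - d\<close>
  windows. Compressing \<open>A\<close> to each window and adding up therefore multiplies the part
  of \<open>A\<close> that raises length by \<open>d\<close> by \<open>N + 1 - d\<close>. This
  finite sum plays the role of integrating the gauge action of the circle against the Fejer kernel.
  The relation \<open>A \<chi>\<^sub>\<gamma> = R\<^sub>\<gamma> (A \<chi>\<^sub>0)\<close> also
  serves the approximation: since \<open>R\<^sub>\<gamma>\<close> is a contraction, convergence on
  every basis vector reduces to convergence of the single family of damped coefficients.\<close>

lemma ell2_outside: "f \<in> ell2 X \<Longrightarrow> x \<notin> X \<Longrightarrow> f x = 0"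
  by (simp add: ell2_def)

lemma ell2_norm_nonneg [simp]: "0 \<le> ell2_norm X f"
  by (simp add: ell2_norm_def infsum_nonneg)

lemma L2_set_le_ell2_norm:
  assumes "f \<in> ell2 X" "finite F" "F \<subseteq> X"
  shows "L2_set (\<lambda>x. cmod (f x)) F \<le> ell2_norm X f"
  unfolding L2_set_def ell2_norm_def using assms
  by (intro real_sqrt_le_mono finite_sum_le_infsum) (auto simp: ell2_def)

lemma norm_le_ell2_norm:
  assumes "f \<in> ell2 X"
  shows "cmod (f x) \<le> ell2_norm X f"
proof (cases "x \<in> X")
  case True
  then show ?thesis using L2_set_le_ell2_norm[OF assms, of "{x}"] by simp
qed (use assms in \<open>simp add: ell2_outside\<close>)

lemma ell2_norm_power2:
  "(ell2_norm X f)\<^sup>2 = (\<Sum>\<^sub>\<infinity>x\<in>X. (cmod (f x))\<^sup>2)"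
  by (simp add: ell2_norm_def infsum_nonneg)

text \<open>Partial sums of squares are monotone, so one bound on all finite subsets yields
  summability and the norm estimate together.\<close>

lemma
  assumes "\<And>x. x \<notin> X \<Longrightarrow> f x = 0"
    and "\<And>F. finite F \<Longrightarrow> F \<subseteq> X \<Longrightarrow> L2_set (\<lambda>x. cmod (f x)) F \<le> K"
  shows ell2_memI: "f \<in> ell2 X" and ell2_norm_leI: "ell2_norm X f \<le> K"
proof -
  have K: "0 \<le> K"
    using assms(2)[of "{}"] by simp
  have le: "(\<Sum>x\<in>F. (cmod (f x))\<^sup>2) \<le> K\<^sup>2" if "finite F" "F \<subseteq> X" for F
    using power_mono[OF assms(2)[OF that], of 2] by (simp add: L2_set_def sum_nonneg)
  have summable: "(\<lambda>x. (cmod (f x))\<^sup>2) summable_on X"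
    by (rule nonneg_bdd_above_summable_on) (use le in \<open>auto simp: bdd_above_def\<close>)
  then show "f \<in> ell2 X"
    using assms(1) by (simp add: ell2_def)
  have "(ell2_norm X f)\<^sup>2 \<le> K\<^sup>2"
    unfolding ell2_norm_power2 by (rule infsum_le_finite_sums[OF summable]) (use le in auto)
  then show "ell2_norm X f \<le> K"
    using K power2_le_imp_le by blast
qed

lemma L2_set_cmod_add_le:
  "L2_set (\<lambda>x. cmod (f x + g x)) F \<le> L2_set (\<lambda>x. cmod (f x)) F + L2_set (\<lambda>x. cmod (g x)) F"
  by (rule order_trans[OF L2_set_mono L2_set_triangle_ineq]) (auto simp: norm_triangle_ineq)

lemma
  assumes "f \<in> ell2 X" "g \<in> ell2 X"
  shows ell2_add: "(\<lambda>x. f x + g x) \<in> ell2 X"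
    and ell2_norm_triangle: "ell2_norm X (\<lambda>x. f x + g x) \<le> ell2_norm X f + ell2_norm X g"
proof -
  have le: "L2_set (\<lambda>x. cmod (f x + g x)) F \<le> ell2_norm X f + ell2_norm X g"
    if "finite F" "F \<subseteq> X" for F
    using L2_set_cmod_add_le[of f g F] L2_set_le_ell2_norm[OF assms(1) that]
      L2_set_le_ell2_norm[OF assms(2) that] by linarith
  show "(\<lambda>x. f x + g x) \<in> ell2 X"
    by (rule ell2_memI[OF _ le]) (use assms in \<open>simp_all add: ell2_outside\<close>)
  show "ell2_norm X (\<lambda>x. f x + g x) \<le> ell2_norm X f + ell2_norm X g"
    by (rule ell2_norm_leI[OF _ le]) (use assms in \<open>simp_all add: ell2_outside\<close>)
qed

lemma ell2_norm_scale: "ell2_norm X (\<lambda>x. c * f x) = cmod c * ell2_norm X f"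
  by (simp add: ell2_norm_def norm_mult power_mult_distrib infsum_cmult_right' real_sqrt_mult)

lemma ell2_scale: "f \<in> ell2 X \<Longrightarrow> (\<lambda>x. c * f x) \<in> ell2 X"
  by (auto simp: ell2_def norm_mult power_mult_distrib intro: summable_on_cmult_right)

lemma ell2_minus: "f \<in> ell2 X \<Longrightarrow> (\<lambda>x. - f x) \<in> ell2 X"
  using ell2_scale[of f X "-1"] by simp

lemma ell2_norm_minus: "ell2_norm X (\<lambda>x. - f x) = ell2_norm X f"
  by (simp add: ell2_norm_def)

lemma ell2_norm_minus_commute: "ell2_norm X (\<lambda>x. f x - g x) = ell2_norm X (\<lambda>x. g x - f x)"
  by (simp add: ell2_norm_def norm_minus_commute)

lemma ell2_diff: "f \<in> ell2 X \<Longrightarrow> g \<in> ell2 X \<Longrightarrow> (\<lambda>x. f x - g x) \<in> ell2 X"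
  using ell2_add[OF _ ell2_minus] by fastforce

lemma ell2_norm_diff_le:
  "f \<in> ell2 X \<Longrightarrow> g \<in> ell2 X \<Longrightarrow> ell2_norm X (\<lambda>x. f x - g x) \<le> ell2_norm X f + ell2_norm X g"
  using ell2_norm_triangle[OF _ ell2_minus, of f X g] by (simp add: ell2_norm_minus)

lemma zero_ell2 [simp]: "(\<lambda>x. 0) \<in> ell2 X"
  by (simp add: ell2_def)

lemma ell2_norm_zero [simp]: "ell2_norm X (\<lambda>x. 0) = 0"
  by (simp add: ell2_norm_def)

lemma
  assumes "finite E" "\<And>b. b \<in> E \<Longrightarrow> g b \<in> ell2 X"
  shows ell2_sum_mem: "(\<lambda>x. \<Sum>b\<in>E. g b x) \<in> ell2 X"
    and ell2_norm_sum_le: "ell2_norm X (\<lambda>x. \<Sum>b\<in>E. g b x) \<le> (\<Sum>b\<in>E. ell2_norm X (g b))"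
proof -
  have "(\<lambda>x. \<Sum>b\<in>E. g b x) \<in> ell2 X \<and>
    ell2_norm X (\<lambda>x. \<Sum>b\<in>E. g b x) \<le> (\<Sum>b\<in>E. ell2_norm X (g b))"
    using assms
  proof (induction E rule: finite_induct)
    case (insert b E)
    then have "g b \<in> ell2 X" "(\<lambda>x. \<Sum>b\<in>E. g b x) \<in> ell2 X"
      by auto
    from ell2_add[OF this] ell2_norm_triangle[OF this] insert show ?case
      by auto
  qed simp
  then show "(\<lambda>x. \<Sum>b\<in>E. g b x) \<in> ell2 X"
    "ell2_norm X (\<lambda>x. \<Sum>b\<in>E. g b x) \<le> (\<Sum>b\<in>E. ell2_norm X (g b))"
    by auto
qed

lemma
  assumes "f \<in> ell2 X" "\<And>x. cmod (g x) \<le> cmod (f x)"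
  shows ell2_dominated: "g \<in> ell2 X" and ell2_norm_mono: "ell2_norm X g \<le> ell2_norm X f"
proof -
  have "L2_set (\<lambda>x. cmod (g x)) F \<le> ell2_norm X f" if "finite F" "F \<subseteq> X" for F
    by (rule order_trans[OF L2_set_mono L2_set_le_ell2_norm[OF assms(1) that]])
      (use assms(2) in auto)
  moreover have "g x = 0" if "x \<notin> X" for x
    using assms(2)[of x] ell2_outside[OF assms(1) that] by simp
  ultimately show "g \<in> ell2 X" "ell2_norm X g \<le> ell2_norm X f"
    by (auto intro!: ell2_memI ell2_norm_leI)
qed

text \<open>The pairing carries no conjugate, so the same estimate serves inner products and
  row-by-column products of matrices.\<close>

lemma
  assumes "f \<in> ell2 X" "g \<in> ell2 X"
  shows ell2_mult_summable_norm: "(\<lambda>x. norm (f x * g x)) summable_on X"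
    and ell2_Cauchy_Schwarz_norm:
      "(\<Sum>\<^sub>\<infinity>x\<in>X. norm (f x * g x)) \<le> ell2_norm X f * ell2_norm X g"
proof -
  have le: "(\<Sum>x\<in>F. norm (f x * g x)) \<le> ell2_norm X f * ell2_norm X g"
    if "finite F" "F \<subseteq> X" for F
  proof -
    have "(\<Sum>x\<in>F. norm (f x * g x)) = (\<Sum>x\<in>F. \<bar>cmod (f x)\<bar> * \<bar>cmod (g x)\<bar>)"
      by (simp add: norm_mult)
    also have "\<dots> \<le> L2_set (\<lambda>x. cmod (f x)) F * L2_set (\<lambda>x. cmod (g x)) F"
      by (rule L2_set_mult_ineq)
    also have "\<dots> \<le> ell2_norm X f * ell2_norm X g"
      by (intro mult_mono L2_set_le_ell2_norm assms that) auto
    finally show ?thesis .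
  qed
  show *: "(\<lambda>x. norm (f x * g x)) summable_on X"
    by (rule nonneg_bdd_above_summable_on) (use le in \<open>auto simp: bdd_above_def\<close>)
  show "(\<Sum>\<^sub>\<infinity>x\<in>X. norm (f x * g x)) \<le> ell2_norm X f * ell2_norm X g"
    by (rule infsum_le_finite_sums[OF *]) (use le in auto)
qed

lemma ell2_Cauchy_Schwarz:
  assumes "f \<in> ell2 X" "g \<in> ell2 X"
  shows "cmod (\<Sum>\<^sub>\<infinity>x\<in>X. f x * g x) \<le> ell2_norm X f * ell2_norm X g"
  using norm_infsum_bound[OF ell2_mult_summable_norm[OF assms]]
    ell2_Cauchy_Schwarz_norm[OF assms] by linarith

lemma ell2_cnj: "g \<in> ell2 X \<Longrightarrow> (\<lambda>x. cnj (g x)) \<in> ell2 X"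
  by (simp add: ell2_def)

lemma ell2_norm_cnj: "ell2_norm X (\<lambda>x. cnj (g x)) = ell2_norm X g"
  by (simp add: ell2_norm_def)

lemma ell2_inner_chi:
  assumes "x \<in> X"
  shows "ell2_inner X f (chi x) = f x"
proof -
  have "ell2_inner X f (chi x) = (\<Sum>\<^sub>\<infinity>y\<in>{x}. f y * cnj (chi x y))"
    unfolding ell2_inner_def by (rule infsum_cong_neutral) (use assms in \<open>auto simp: chi_def\<close>)
  then show ?thesis by (simp add: chi_def)
qed

lemma ell2_norm_chi:
  assumes "x \<in> X"
  shows "ell2_norm X (chi x) = 1"
proof -
  have "(\<Sum>\<^sub>\<infinity>y\<in>X. (cmod (chi x y))\<^sup>2) = (\<Sum>\<^sub>\<infinity>y\<in>{x}. (cmod (chi x y))\<^sup>2)"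
    by (rule infsum_cong_neutral) (use assms in \<open>auto simp: chi_def\<close>)
  then show ?thesis by (simp add: ell2_norm_def) (simp add: chi_def)
qed

lemma chi_eq: "chi x y = (if x = y then 1 else 0)"
  by (simp add: chi_def)

lemma ell2_eq_of_norm_diff_zero:
  assumes "f \<in> ell2 X" "g \<in> ell2 X" "ell2_norm X (\<lambda>x. f x - g x) = 0"
  shows "f = g"
  using norm_le_ell2_norm[OF ell2_diff[OF assms(1,2)]] assms(3) by (auto simp: fun_eq_iff)

lemma ell2_cutoff: "f \<in> ell2 X \<Longrightarrow> (\<lambda>x. if x \<in> E then f x else 0) \<in> ell2 X"
  by (rule ell2_dominated) auto

text \<open>The squared norm of the tail is the full sum minus a finite partial sum. This is the
  density of finitely supported families.\<close>

lemma tendsto_ell2_norm_cutoff: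
  assumes f: "f \<in> ell2 X"
  shows "((\<lambda>E. ell2_norm X (\<lambda>x. if x \<in> E then 0 else f x)) \<longlongrightarrow> 0) (finite_subsets_at_top X)"
proof -
  let ?q = "\<lambda>x. (cmod (f x))\<^sup>2"
  have q: "?q summable_on X"
    using f by (simp add: ell2_def)
  have "((\<lambda>E. sqrt (infsum ?q X - sum ?q E)) \<longlongrightarrow> sqrt (infsum ?q X - infsum ?q X))
      (finite_subsets_at_top X)"
    using infsum_tendsto[OF q] by (intro tendsto_intros)
  moreover have "\<forall>\<^sub>F E in finite_subsets_at_top X. sqrt (infsum ?q X - sum ?q E) =
      ell2_norm X (\<lambda>x. if x \<in> E then 0 else f x)"
  proof (rule eventually_finite_subsets_at_top_weakI)
    fix E assume E: "finite E" "E \<subseteq> X"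
    have "infsum ?q X - sum ?q E = infsum ?q (X - E)"
      using infsum_Diff[OF q, of E] E by auto
    also have "\<dots> = (\<Sum>\<^sub>\<infinity>x\<in>X. (cmod (if x \<in> E then 0 else f x))\<^sup>2)"
      by (rule infsum_cong_neutral) auto
    finally show "sqrt (infsum ?q X - sum ?q E) = ell2_norm X (\<lambda>x. if x \<in> E then 0 else f x)"
      by (simp add: ell2_norm_def)
  qed
  ultimately show ?thesis
    by (auto dest: tendsto_cong[THEN iffD1])
qed

lemma ell2_obtain_cutoff:
  assumes "f \<in> ell2 X" "0 < \<epsilon>"
  obtains E where "finite E" "E \<subseteq> X" "ell2_norm X (\<lambda>x. if x \<in> E then 0 else f x) < \<epsilon>"
proof -
  have "\<forall>\<^sub>F E in finite_subsets_at_top X. ell2_norm X (\<lambda>x. if x \<in> E then 0 else f x) < \<epsilon>"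
    using order_tendstoD(2)[OF tendsto_ell2_norm_cutoff[OF assms(1)] assms(2)] .
  then show ?thesis
    using that by (auto simp: eventually_finite_subsets_at_top)
qed

text \<open>Outside a finite set \<open>E\<close> the tail of \<open>f\<close> bounds all
  \<open>g m\<close> at once; on \<open>E\<close> only finitely many coordinates have to
  converge.\<close>

lemma ell2_dominated_convergence:
  fixes g :: "nat \<Rightarrow> 'a \<Rightarrow> complex"
  assumes f: "f \<in> ell2 X"
    and dom: "\<And>m x. cmod (g m x) \<le> cmod (f x)"
    and lim: "\<And>x. x \<in> X \<Longrightarrow> (\<lambda>m. g m x) \<longlonglongrightarrow> 0"
  shows "(\<lambda>m. ell2_norm X (g m)) \<longlonglongrightarrow> 0"
proof (rule LIMSEQ_I)
  fix \<epsilon> :: real assume "0 < \<epsilon>"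
  then obtain E where E: "finite E" "E \<subseteq> X"
    "ell2_norm X (\<lambda>x. if x \<in> E then 0 else f x) < \<epsilon> / 2"
    using ell2_obtain_cutoff[OF f, of "\<epsilon> / 2"] by auto
  have g: "g m \<in> ell2 X" for m
    by (rule ell2_dominated[OF f dom])
  have chi: "chi y \<in> ell2 X" if "y \<in> E" for y
    using that E by (auto intro: chi_in_ell2)
  have fE: "(\<lambda>x. if x \<in> E then 0 else f x) \<in> ell2 X"
    by (rule ell2_dominated[OF f]) auto
  have bound: "ell2_norm X (g m) \<le> (\<Sum>y\<in>E. cmod (g m y)) + \<epsilon> / 2" for m
  proof -
    let ?h = "\<lambda>x. if x \<in> E then 0 else g m x"
    have eq: "g m = (\<lambda>x. (\<Sum>y\<in>E. g m y * chi y x) + ?h x)"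
      using E(1) by (auto simp: fun_eq_iff chi_eq if_distrib[of "\<lambda>z. _ * z"] cong: if_cong)
    have "cmod (?h x) \<le> cmod (if x \<in> E then 0 else f x)" for x
      by (simp add: dom)
    then have h: "?h \<in> ell2 X" "ell2_norm X ?h \<le> \<epsilon> / 2"
      using E(3) ell2_dominated[OF fE, of ?h] ell2_norm_mono[OF fE, of ?h] by auto
    have s: "(\<lambda>x. \<Sum>y\<in>E. g m y * chi y x) \<in> ell2 X"
      by (intro ell2_sum_mem E ell2_scale chi)
    have "ell2_norm X (g m) \<le> ell2_norm X (\<lambda>x. \<Sum>y\<in>E. g m y * chi y x) + ell2_norm X ?h"
      by (subst eq) (rule ell2_norm_triangle[OF s h(1)])
    also have "ell2_norm X (\<lambda>x. \<Sum>y\<in>E. g m y * chi y x)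
        \<le> (\<Sum>y\<in>E. ell2_norm X (\<lambda>x. g m y * chi y x))"
      by (intro ell2_norm_sum_le E ell2_scale chi)
    also have "\<dots> = (\<Sum>y\<in>E. cmod (g m y))"
      by (rule sum.cong) (use E in \<open>auto simp: ell2_norm_scale ell2_norm_chi\<close>)
    finally show ?thesis using h(2) by simp
  qed
  have "(\<lambda>m. \<Sum>y\<in>E. cmod (g m y)) \<longlonglongrightarrow> (\<Sum>y\<in>E. cmod 0)"
    by (intro tendsto_intros lim) (use E in auto)
  then have "\<forall>\<^sub>F m in sequentially. (\<Sum>y\<in>E. cmod (g m y)) < \<epsilon> / 2"
    using \<open>0 < \<epsilon>\<close> by (intro order_tendstoD(2)[where y = 0]) auto
  then obtain m0 where "\<And>m. m \<ge> m0 \<Longrightarrow> (\<Sum>y\<in>E. cmod (g m y)) < \<epsilon> / 2"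
    by (auto simp: eventually_sequentially)
  then have "norm (ell2_norm X (g m) - 0) < \<epsilon>" if "m \<ge> m0" for m
    using bound[of m] that by fastforce
  then show "\<exists>m0. \<forall>m\<ge>m0. norm (ell2_norm X (g m) - 0) < \<epsilon>"
    by blast
qed

lemma ell2_norm_finite_support:
  assumes "finite E" "E \<subseteq> X" "\<And>x. x \<notin> E \<Longrightarrow> f x = 0"
  shows "ell2_norm X f = L2_set (\<lambda>x. cmod (f x)) E"
proof -
  have "(\<Sum>\<^sub>\<infinity>x\<in>X. (cmod (f x))\<^sup>2) = (\<Sum>\<^sub>\<infinity>x\<in>E. (cmod (f x))\<^sup>2)"
    by (rule infsum_cong_neutral) (use assms in auto)
  then show ?thesis
    using assms(1) by (simp add: ell2_norm_def L2_set_def)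
qed

text \<open>Ensures that the definite description in \<open>ell2_sum\<close> denotes the limit once
  some limit has been exhibited.\<close>

lemma ell2_has_sum_unique:
  assumes u: "ell2_has_sum X g J u" and v: "ell2_has_sum X g J v"
    and g: "\<And>b. b \<in> J \<Longrightarrow> g b \<in> ell2 X"
  shows "u = v"
proof (rule ell2_eq_of_norm_diff_zero)
  show uv: "u \<in> ell2 X" "v \<in> ell2 X"
    using u v by (auto simp: ell2_has_sum_def)
  let ?d = "\<lambda>u E. ell2_norm X (\<lambda>x. (\<Sum>b\<in>E. g b x) - u x)"
  have "((\<lambda>E. ?d u E + ?d v E) \<longlongrightarrow> 0 + 0) (finite_subsets_at_top J)"
    by (rule tendsto_add) (use u v in \<open>auto simp: ell2_has_sum_def\<close>)
  moreover have "\<forall>\<^sub>F E in finite_subsets_at_top J. ell2_norm X (\<lambda>x. u x - v x) \<le> ?d u E + ?d v E"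
  proof (rule eventually_finite_subsets_at_top_weakI)
    fix E assume E: "finite E" "E \<subseteq> J"
    have s: "(\<lambda>x. \<Sum>b\<in>E. g b x) \<in> ell2 X"
      by (rule ell2_sum_mem[OF E(1)]) (use E g in auto)
    from ell2_norm_diff_le[OF ell2_diff[OF s uv(2)] ell2_diff[OF s uv(1)]]
    show "ell2_norm X (\<lambda>x. u x - v x) \<le> ?d u E + ?d v E"
      by simp
  qed
  ultimately have "ell2_norm X (\<lambda>x. u x - v x) \<le> 0"
    using tendsto_lowerbound[OF _ _ finite_subsets_at_top_neq_bot] by fastforce
  then show "ell2_norm X (\<lambda>x. u x - v x) = 0"
    using ell2_norm_nonneg[of X "\<lambda>x. u x - v x"] by linarith
qed

lemma chi_ell2_span: "\<gamma> \<in> X \<Longrightarrow> chi \<gamma> \<in> ell2_span X"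
  by (simp add: ell2_span_def chi_eq)

section \<open>Bounded operators\<close>

lemma bops_ell2: "T \<in> bops X \<Longrightarrow> f \<in> ell2 X \<Longrightarrow> T f \<in> ell2 X"
  by (auto simp: bops_def)

lemma bops_add:
  "T \<in> bops X \<Longrightarrow> f \<in> ell2 X \<Longrightarrow> g \<in> ell2 X \<Longrightarrow> T (\<lambda>x. f x + g x) = (\<lambda>x. T f x + T g x)"
  by (simp add: bops_def)

lemma bops_scale: "T \<in> bops X \<Longrightarrow> f \<in> ell2 X \<Longrightarrow> T (\<lambda>x. c * f x) = (\<lambda>x. c * T f x)"
  by (simp add: bops_def)

lemma bops_bound:
  assumes "T \<in> bops X"
  obtains M where "0 \<le> M" "\<And>f. f \<in> ell2 X \<Longrightarrow> ell2_norm X (T f) \<le> M * ell2_norm X f"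
proof -
  from assms obtain M where M: "\<And>f. f \<in> ell2 X \<Longrightarrow> ell2_norm X (T f) \<le> M * ell2_norm X f"
    unfolding bops_def by blast
  \<comment> \<open>The constant in \<open>bops\<close> carries no sign condition; its absolute
    value is a nonnegative bound.\<close>
  have "ell2_norm X (T f) \<le> \<bar>M\<bar> * ell2_norm X f" if "f \<in> ell2 X" for f
    by (rule order_trans[OF M[OF that]]) (simp add: mult_right_mono)
  then show ?thesis
    using that[of "\<bar>M\<bar>"] by simp
qed

lemma bops_zero: "T \<in> bops X \<Longrightarrow> T (\<lambda>x. 0) = (\<lambda>x. 0)"
  using bops_scale[of T X "\<lambda>x. 0" 0] by simp

lemma bops_diff:
  assumes "T \<in> bops X" "f \<in> ell2 X" "g \<in> ell2 X"
  shows "T (\<lambda>x. f x - g x) = (\<lambda>x. T f x - T g x)"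
  using bops_add[OF assms(1,2) ell2_scale[OF assms(3), of "-1"]] bops_scale[OF assms(1,3), of "-1"]
  by simp

lemma bopsI:
  assumes "\<And>f. f \<in> ell2 X \<Longrightarrow> T f \<in> ell2 X"
    and "\<And>f. f \<notin> ell2 X \<Longrightarrow> T f = undefined"
    and "\<And>f g. f \<in> ell2 X \<Longrightarrow> g \<in> ell2 X \<Longrightarrow> T (\<lambda>x. f x + g x) = (\<lambda>x. T f x + T g x)"
    and "\<And>c f. f \<in> ell2 X \<Longrightarrow> T (\<lambda>x. c * f x) = (\<lambda>x. c * T f x)"
    and "\<And>f. f \<in> ell2 X \<Longrightarrow> ell2_norm X (T f) \<le> M * ell2_norm X f"
  shows "T \<in> bops X"
proof -
  have "T \<in> ell2 X \<rightarrow>\<^sub>E ell2 X"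
    using assms(1,2) by (simp add: PiE_def extensional_def)
  moreover have "\<exists>M. \<forall>f\<in>ell2 X. ell2_norm X (T f) \<le> M * ell2_norm X f"
    using assms(5) by blast
  ultimately show ?thesis
    using assms(3,4) by (simp add: bops_def)
qed

lemma bops_ext:
  assumes "S \<in> bops X" "T \<in> bops X" "\<And>f. f \<in> ell2 X \<Longrightarrow> S f = T f"
  shows "S = T"
proof (rule PiE_ext)
  show "S \<in> ell2 X \<rightarrow>\<^sub>E ell2 X" "T \<in> ell2 X \<rightarrow>\<^sub>E ell2 X"
    using assms(1,2) by (simp_all add: bops_def)
qed (rule assms(3))

lemma op_id_bops: "op_id X \<in> bops X"
  by (rule bopsI[where M = 1]) (auto simp: op_id_def ell2_add ell2_scale)

lemma op_add_bops:
  assumes "S \<in> bops X" "T \<in> bops X"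
  shows "op_add X S T \<in> bops X"
proof -
  obtain M where M: "\<And>f. f \<in> ell2 X \<Longrightarrow> ell2_norm X (S f) \<le> M * ell2_norm X f"
    using bops_bound[OF assms(1)] by blast
  obtain N where N: "\<And>f. f \<in> ell2 X \<Longrightarrow> ell2_norm X (T f) \<le> N * ell2_norm X f"
    using bops_bound[OF assms(2)] by blast
  show ?thesis
  proof (rule bopsI[where M = "M + N"])
    fix f assume f: "f \<in> ell2 X"
    then show "ell2_norm X (op_add X S T f) \<le> (M + N) * ell2_norm X f"
      using ell2_norm_triangle[OF bops_ell2[OF assms(1) f] bops_ell2[OF assms(2) f]] M[OF f] N[OF f]
      by (simp add: op_add_def distrib_right)
  qed (use assms in \<open>auto simp: op_add_def bops_ell2 ell2_add ell2_scale bops_add bops_scale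
      algebra_simps\<close>)
qed

lemma op_scale_bops:
  assumes "T \<in> bops X"
  shows "op_scale X c T \<in> bops X"
proof -
  obtain M where M: "\<And>f. f \<in> ell2 X \<Longrightarrow> ell2_norm X (T f) \<le> M * ell2_norm X f"
    using bops_bound[OF assms(1)] by blast
  show ?thesis
  proof (rule bopsI[where M = "cmod c * M"])
    fix f assume f: "f \<in> ell2 X"
    then show "ell2_norm X (op_scale X c T f) \<le> cmod c * M * ell2_norm X f"
      using mult_left_mono[OF M[OF f], of "cmod c"]
      by (simp add: op_scale_def ell2_norm_scale mult.assoc)
  qed (use assms in \<open>auto simp: op_scale_def bops_ell2 ell2_add ell2_scale bops_add bops_scale
      algebra_simps\<close>)
qed

lemma op_mult_bops:
  assumes "S \<in> bops X" "T \<in> bops X"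
  shows "op_mult X S T \<in> bops X"
proof -
  obtain M where M: "0 \<le> M" "\<And>f. f \<in> ell2 X \<Longrightarrow> ell2_norm X (S f) \<le> M * ell2_norm X f"
    using bops_bound[OF assms(1)] by blast
  obtain N where N: "\<And>f. f \<in> ell2 X \<Longrightarrow> ell2_norm X (T f) \<le> N * ell2_norm X f"
    using bops_bound[OF assms(2)] by blast
  show ?thesis
  proof (rule bopsI[where M = "M * N"])
    fix f assume f: "f \<in> ell2 X"
    then show "ell2_norm X (op_mult X S T f) \<le> M * N * ell2_norm X f"
      using M(2)[OF bops_ell2[OF assms(2) f]] mult_left_mono[OF N[OF f] M(1)]
      by (simp add: compose_def mult.assoc)
  qed (use assms in \<open>auto simp: compose_def bops_ell2 ell2_add ell2_scale bops_add bops_scale\<close>)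
qed

lemma bops_finite_sum:
  assumes T: "T \<in> bops X" and "finite E" "E \<subseteq> X"
  shows "T (\<lambda>x. \<Sum>y\<in>E. a y * chi y x) = (\<lambda>x. \<Sum>y\<in>E. a y * T (chi y) x)"
  using assms(2,3)
proof (induction E rule: finite_induct)
  case empty
  then show ?case using bops_zero[OF T] by simp
next
  case (insert z E)
  then have "chi z \<in> ell2 X" "\<And>y. y \<in> E \<Longrightarrow> chi y \<in> ell2 X"
    by (auto intro: chi_in_ell2)
  then have "(\<lambda>x. a z * chi z x) \<in> ell2 X" "(\<lambda>x. \<Sum>y\<in>E. a y * chi y x) \<in> ell2 X"
    using insert by (auto intro!: ell2_scale ell2_sum_mem)
  from bops_add[OF T this] insert bops_scale[OF T \<open>chi z \<in> ell2 X\<close>] show ?case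
    by simp
qed

lemma cutoff_eq_sum_chi:
  "finite E \<Longrightarrow> (\<lambda>x. if x \<in> E then f x else 0) = (\<lambda>x. \<Sum>y\<in>E. f y * chi y x)"
  by (auto simp: fun_eq_iff chi_eq if_distrib[of "\<lambda>z. _ * z"] cong: if_cong)

lemma bops_cutoff:
  assumes "T \<in> bops X" "finite E" "E \<subseteq> X"
  shows "T (\<lambda>x. if x \<in> E then f x else 0) = (\<lambda>x. \<Sum>y\<in>E. f y * T (chi y) x)"
  by (simp add: cutoff_eq_sum_chi[OF assms(2)] bops_finite_sum[OF assms])

lemma bops_diff_cutoff:
  assumes "T \<in> bops X" "f \<in> ell2 X"
  shows "T (\<lambda>x. if x \<in> E then 0 else f x) = (\<lambda>x. T f x - T (\<lambda>x. if x \<in> E then f x else 0) x)"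
proof -
  have "(\<lambda>x. if x \<in> E then 0 else f x) = (\<lambda>x. f x - (if x \<in> E then f x else 0))"
    by auto
  then show ?thesis
    using bops_diff[OF assms ell2_cutoff[OF assms(2), of E]] by simp
qed

text \<open>Matrix expansion: by boundedness, the values of \<open>T\<close> on the finite cut-offs
  of \<open>f\<close> converge in norm, hence in each coordinate. So an operator is determined by
  its columns \<open>T (chi y)\<close>.\<close>

lemma bops_has_sum:
  assumes T: "T \<in> bops X" and f: "f \<in> ell2 X"
  shows "((\<lambda>y. f y * T (chi y) x) has_sum T f x) X"
proof -
  obtain M where M: "0 \<le> M" "\<And>f. f \<in> ell2 X \<Longrightarrow> ell2_norm X (T f) \<le> M * ell2_norm X f"
    using bops_bound[OF T] by blast
  let ?t = "\<lambda>E. ell2_norm X (\<lambda>x. if x \<in> E then 0 else f x)"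
  have "\<forall>\<^sub>F E in finite_subsets_at_top X. norm ((\<Sum>y\<in>E. f y * T (chi y) x) - T f x) \<le> M * ?t E"
  proof (rule eventually_finite_subsets_at_top_weakI)
    fix E assume E: "finite E" "E \<subseteq> X"
    have fE: "(\<lambda>x. if x \<in> E then 0 else f x) \<in> ell2 X"
      by (rule ell2_dominated[OF f]) auto
    have "norm ((\<Sum>y\<in>E. f y * T (chi y) x) - T f x) = norm (T (\<lambda>x. if x \<in> E then 0 else f x) x)"
      by (simp add: bops_diff_cutoff[OF T f] bops_cutoff[OF T E] norm_minus_commute)
    also have "\<dots> \<le> M * ?t E"
      using norm_le_ell2_norm[OF bops_ell2[OF T fE]] M(2)[OF fE] by (rule order_trans)
    finally show "norm ((\<Sum>y\<in>E. f y * T (chi y) x) - T f x) \<le> M * ?t E" .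
  qed
  moreover have "((\<lambda>E. M * ?t E) \<longlongrightarrow> 0) (finite_subsets_at_top X)"
    using tendsto_mult_right_zero[OF tendsto_ell2_norm_cutoff[OF f]] by simp
  ultimately show ?thesis
    unfolding has_sum_def by (rule Lim_null_comparison[THEN Lim_null[THEN iffD2]])
qed

lemma bops_eqI:
  assumes "S \<in> bops X" "T \<in> bops X" "\<And>x. x \<in> X \<Longrightarrow> S (chi x) = T (chi x)"
  shows "S = T"
proof (rule bops_ext[OF assms(1,2)], rule ext)
  fix f x assume f: "f \<in> ell2 X"
  have "((\<lambda>y. f y * S (chi y) x) has_sum S f x) X = ((\<lambda>y. f y * T (chi y) x) has_sum S f x) X"
    by (rule has_sum_cong) (simp add: assms(3))
  with bops_has_sum[OF assms(1) f] bops_has_sum[OF assms(2) f] show "S f x = T f x"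
    by (blast dest: has_sum_unique)
qed

lemma ell2_span_subset: "ell2_span X \<subseteq> ell2 X"
proof
  fix p assume p: "p \<in> ell2_span X"
  let ?E = "{x. p x \<noteq> 0}"
  have "p = (\<lambda>x. if x \<in> ?E then p x else 0)"
    by auto
  also have "\<dots> = (\<lambda>x. \<Sum>y\<in>?E. p y * chi y x)"
    using p by (intro cutoff_eq_sum_chi) (simp add: ell2_span_def)
  also have "\<dots> \<in> ell2 X"
    using p by (intro ell2_sum_mem ell2_scale chi_in_ell2) (auto simp: ell2_span_def)
  finally show "p \<in> ell2 X" .
qed

lemma bops_span:
  assumes "T \<in> bops X" "p \<in> ell2_span X"
  shows "T p = (\<lambda>x. \<Sum>y | p y \<noteq> 0. p y * T (chi y) x)"
proof -
  have "T p = T (\<lambda>x. if x \<in> {x. p x \<noteq> 0} then p x else 0)"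
    by (rule arg_cong[where f = T]) auto
  also have "\<dots> = (\<lambda>x. \<Sum>y | p y \<noteq> 0. p y * T (chi y) x)"
    using assms by (intro bops_cutoff) (auto simp: ell2_span_def)
  finally show ?thesis .
qed

text \<open>Extends a bound by density; the Fejer means are first estimated on finitely supported
  vectors.\<close>

lemma bops_norm_le_from_span:
  assumes T: "T \<in> bops X" and K: "0 \<le> K"
    and le: "\<And>p. p \<in> ell2_span X \<Longrightarrow> ell2_norm X (T p) \<le> K * ell2_norm X p"
    and f: "f \<in> ell2 X"
  shows "ell2_norm X (T f) \<le> K * ell2_norm X f"
proof -
  \<comment> \<open>Any bound for \<open>T\<close> will do here: \<open>M\<close> multiplies only
    the tail of \<open>f\<close> and disappears in the limit.\<close>
  obtain M where M: "0 \<le> M" "\<And>f. f \<in> ell2 X \<Longrightarrow> ell2_norm X (T f) \<le> M * ell2_norm X f"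
    using bops_bound[OF T] by blast
  let ?t = "\<lambda>E. ell2_norm X (\<lambda>x. if x \<in> E then 0 else f x)"
  have "\<forall>\<^sub>F E in finite_subsets_at_top X. ell2_norm X (T f) \<le> K * ell2_norm X f + M * ?t E"
  proof (rule eventually_finite_subsets_at_top_weakI)
    fix E assume E: "finite E" "E \<subseteq> X"
    let ?p = "\<lambda>x. if x \<in> E then f x else 0" and ?q = "\<lambda>x. if x \<in> E then 0 else f x"
    have q: "?q \<in> ell2 X"
      by (rule ell2_dominated[OF f]) auto
    have p: "?p \<in> ell2 X"
      by (rule ell2_cutoff[OF f])
    have "{x. ?p x \<noteq> 0} \<subseteq> E"
      by auto
    then have "?p \<in> ell2_span X"
      using E finite_subset by (auto simp: ell2_span_def)
    then have "ell2_norm X (T ?p) \<le> K * ell2_norm X ?p"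
      by (rule le)
    also have "\<dots> \<le> K * ell2_norm X f"
      by (rule mult_left_mono[OF ell2_norm_mono[OF f] K]) auto
    finally have 1: "ell2_norm X (T ?p) \<le> K * ell2_norm X f" .
    have "T f = (\<lambda>x. T ?p x + T ?q x)"
      by (simp add: bops_diff_cutoff[OF T f])
    then have "ell2_norm X (T f) \<le> ell2_norm X (T ?p) + ell2_norm X (T ?q)"
      using ell2_norm_triangle[OF bops_ell2[OF T p] bops_ell2[OF T q]] by simp
    then show "ell2_norm X (T f) \<le> K * ell2_norm X f + M * ?t E"
      using 1 M(2)[OF q] by linarith
  qed
  moreover have "((\<lambda>E. K * ell2_norm X f + M * ?t E) \<longlongrightarrow> K * ell2_norm X f + M * 0)
      (finite_subsets_at_top X)"
    by (intro tendsto_intros tendsto_ell2_norm_cutoff[OF f])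
  ultimately show ?thesis
    using tendsto_lowerbound finite_subsets_at_top_neq_bot by fastforce
qed

section \<open>Algebras generated by bounded operators\<close>

lemma op_algebra_bops:
  assumes "G \<subseteq> bops X" "T \<in> op_algebra X G"
  shows "T \<in> bops X"
  using assms(2)
  by induction (use assms(1) in \<open>auto intro: op_id_bops op_add_bops op_scale_bops op_mult_bops\<close>)

text \<open>The commutant of a bounded linear \<open>R\<close> contains the identity and is closed
  under sums, scalar multiples and products.\<close>

lemma op_algebra_commute:
  assumes G: "G \<subseteq> bops X" and R: "R \<in> bops X"
    and comm: "\<And>T f. T \<in> G \<Longrightarrow> f \<in> ell2 X \<Longrightarrow> T (R f) = R (T f)"
    and "T \<in> op_algebra X G" "f \<in> ell2 X"
  shows "T (R f) = R (T f)"
  using assms(4,5)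
proof (induction arbitrary: f)
  case (mult S T)
  then show ?case
    using op_algebra_bops[OF G] R by (simp add: compose_def bops_ell2)
qed (use op_algebra_bops[OF G] R comm in \<open>auto simp: op_id_def op_add_def op_scale_def
    bops_ell2 bops_add bops_scale\<close>)

lemma op_algebra_sum:
  assumes "finite F" "\<And>b. b \<in> F \<Longrightarrow> T b \<in> op_algebra X G"
  shows "(\<lambda>f\<in>ell2 X. \<lambda>x. \<Sum>b\<in>F. a b * T b f x) \<in> op_algebra X G"
  using assms
proof (induction F rule: finite_induct)
  case empty
  \<comment> \<open>The empty sum is the zero operator, which the rules of \<open>op_algebra\<close>
    produce as \<open>0\<close> times the identity.\<close>
  have "op_scale X 0 (op_id X) \<in> op_algebra X G"
    by (intro op_algebra.intros)
  then show ?case by (simp add: op_scale_def restrict_def)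
next
  case (insert b F)
  have "op_add X (op_scale X (a b) (T b)) (\<lambda>f\<in>ell2 X. \<lambda>x. \<Sum>b\<in>F. a b * T b f x)
      \<in> op_algebra X G"
    by (intro op_algebra.add op_algebra.scale insert.IH insert.prems) auto
  also have "op_add X (op_scale X (a b) (T b)) (\<lambda>f\<in>ell2 X. \<lambda>x. \<Sum>b\<in>F. a b * T b f x) =
      (\<lambda>f\<in>ell2 X. \<lambda>x. \<Sum>b\<in>insert b F. a b * T b f x)"
    using insert by (auto simp: op_add_def op_scale_def restrict_def fun_eq_iff)
  finally show ?case .
qed

text \<open>Common form of the left and right shifts, chosen so that \<open>shift\<close> unfolds to
  it directly. For injective \<open>\<tau>\<close> at most one term of the sum is nonzero.\<close>

definition weighted_shift :: "'a set \<Rightarrow> ('a \<Rightarrow> 'a) \<Rightarrow> ('a \<Rightarrow> complex) \<Rightarrow> 'a oper" where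
  "weighted_shift X \<tau> w = (\<lambda>f\<in>ell2 X. \<lambda>y. \<Sum>\<^sub>\<infinity>x\<in>X. f x * (w x * chi (\<tau> x) y))"

lemma weighted_shift_image:
  assumes "inj_on \<tau> X" "x \<in> X" "f \<in> ell2 X"
  shows "weighted_shift X \<tau> w f (\<tau> x) = w x * f x"
proof -
  have "weighted_shift X \<tau> w f (\<tau> x) = (\<Sum>\<^sub>\<infinity>z\<in>{x}. f z * (w z * chi (\<tau> z) (\<tau> x)))"
    unfolding weighted_shift_def restrict_apply'[OF assms(3)]
    by (rule infsum_cong_neutral) (use assms in \<open>auto simp: chi_eq inj_on_def\<close>)
  then show ?thesis by (simp add: chi_eq)
qed

lemma weighted_shift_outside:
  assumes "y \<notin> \<tau> ` X" "f \<in> ell2 X"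
  shows "weighted_shift X \<tau> w f y = 0"
  unfolding weighted_shift_def restrict_apply'[OF assms(2)]
  by (rule infsum_0) (use assms in \<open>auto simp: chi_eq\<close>)

lemma weighted_shift_chi:
  assumes "inj_on \<tau> X" "x \<in> X"
  shows "weighted_shift X \<tau> w (chi x) = (\<lambda>y. w x * chi (\<tau> x) y)"
proof
  fix y
  show "weighted_shift X \<tau> w (chi x) y = w x * chi (\<tau> x) y"
  proof (cases "y \<in> \<tau> ` X")
    case True
    then obtain z where z: "z \<in> X" "y = \<tau> z" by auto
    then show ?thesis
      using weighted_shift_image[OF assms(1) z(1) chi_in_ell2[OF assms(2)]] assms
      by (auto simp: chi_eq inj_on_def)
  next
    case False
    then show ?thesis
      using weighted_shift_outside[OF False chi_in_ell2[OF assms(2)]] assms by (auto simp: chi_eq)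
  qed
qed

context
  fixes X :: "'a set" and \<tau> :: "'a \<Rightarrow> 'a" and w :: "'a \<Rightarrow> complex"
  assumes inj: "inj_on \<tau> X" and maps: "\<tau> ` X \<subseteq> X" and w: "\<And>x. x \<in> X \<Longrightarrow> cmod (w x) \<le> 1"
begin

text \<open>Since \<open>\<tau>\<close> is injective, the partial sum of squares of the image over
  \<open>F\<close> pulls back to a sum over the preimage of \<open>F\<close>, with weights of
  modulus at most 1.\<close>

lemma
  assumes f: "f \<in> ell2 X"
  shows weighted_shift_ell2: "weighted_shift X \<tau> w f \<in> ell2 X"
    and weighted_shift_norm_le: "ell2_norm X (weighted_shift X \<tau> w f) \<le> ell2_norm X f"
proof -
  let ?g = "weighted_shift X \<tau> w f"
  have "L2_set (\<lambda>y. cmod (?g y)) F \<le> ell2_norm X f" if F: "finite F" for F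
  proof -
    define E where "E = {x \<in> X. \<tau> x \<in> F}"
    have injE: "inj_on \<tau> E"
      by (rule inj_on_subset[OF inj]) (auto simp: E_def)
    have E: "finite E" "E \<subseteq> X"
      using finite_subset[of "\<tau> ` E" F] finite_imageD[OF _ injE] F by (auto simp: E_def)
    have "?g y = 0" if "y \<in> F - \<tau> ` E" for y
      by (rule weighted_shift_outside[OF _ f]) (use that in \<open>auto simp: E_def\<close>)
    then have "(\<Sum>y\<in>F. (cmod (?g y))\<^sup>2) = (\<Sum>y\<in>\<tau> ` E. (cmod (?g y))\<^sup>2)"
      using F by (intro sum.mono_neutral_right) (auto simp: E_def)
    also have "\<dots> = (\<Sum>x\<in>E. (cmod (w x * f x))\<^sup>2)"
      by (subst sum.reindex[OF injE], intro sum.cong)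
        (use E in \<open>auto simp: weighted_shift_image[OF inj _ f] subset_iff\<close>)
    also have "\<dots> \<le> (\<Sum>x\<in>E. (cmod (f x))\<^sup>2)"
      using E w by (intro sum_mono power_mono) (auto simp: norm_mult mult_left_le_one_le)
    finally have "L2_set (\<lambda>y. cmod (?g y)) F \<le> L2_set (\<lambda>x. cmod (f x)) E"
      by (simp add: L2_set_def)
    also have "\<dots> \<le> ell2_norm X f"
      by (rule L2_set_le_ell2_norm[OF f E])
    finally show ?thesis .
  qed
  moreover have "?g y = 0" if "y \<notin> X" for y
    using weighted_shift_outside[OF _ f] that maps by blast
  ultimately show "?g \<in> ell2 X" "ell2_norm X ?g \<le> ell2_norm X f"
    by (auto intro!: ell2_memI ell2_norm_leI)
qed

lemma weighted_shift_bops: "weighted_shift X \<tau> w \<in> bops X"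
proof (rule bopsI[where M = 1])
  fix f g assume fg: "f \<in> ell2 X" "g \<in> ell2 X"
  show "weighted_shift X \<tau> w (\<lambda>x. f x + g x) =
      (\<lambda>x. weighted_shift X \<tau> w f x + weighted_shift X \<tau> w g x)"
  proof
    fix y
    show "weighted_shift X \<tau> w (\<lambda>x. f x + g x) y =
        weighted_shift X \<tau> w f y + weighted_shift X \<tau> w g y"
      using fg ell2_add[OF fg]
      by (cases "y \<in> \<tau> ` X")
        (auto simp: weighted_shift_image[OF inj] weighted_shift_outside distrib_left)
  qed
next
  fix c f assume f: "f \<in> ell2 X"
  show "weighted_shift X \<tau> w (\<lambda>x. c * f x) = (\<lambda>x. c * weighted_shift X \<tau> w f x)"
  proof
    fix y
    show "weighted_shift X \<tau> w (\<lambda>x. c * f x) y = c * weighted_shift X \<tau> w f y"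
      using f ell2_scale[OF f]
      by (cases "y \<in> \<tau> ` X") (auto simp: weighted_shift_image[OF inj] weighted_shift_outside)
  qed
qed (use weighted_shift_ell2 weighted_shift_norm_le in \<open>auto simp: weighted_shift_def\<close>)

end

section \<open>Operator topologies\<close>

lemma infsum_finite_sum:
  fixes f :: "'a \<Rightarrow> 'b \<Rightarrow> real"
  assumes "finite F" "\<And>x. x \<in> F \<Longrightarrow> f x summable_on X"
  shows "(\<Sum>\<^sub>\<infinity>y\<in>X. \<Sum>x\<in>F. f x y) = (\<Sum>x\<in>F. infsum (f x) X)"
    and "(\<lambda>y. \<Sum>x\<in>F. f x y) summable_on X"
proof -
  have "((\<lambda>y. \<Sum>x\<in>F. f x y) has_sum (\<Sum>x\<in>F. infsum (f x) X)) X"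
    using assms by (induction F rule: finite_induct) (auto intro!: has_sum_add)
  then show "(\<Sum>\<^sub>\<infinity>y\<in>X. \<Sum>x\<in>F. f x y) = (\<Sum>x\<in>F. infsum (f x) X)"
    "(\<lambda>y. \<Sum>x\<in>F. f x y) summable_on X"
    by (auto simp: infsumI has_sum_imp_summable)
qed

lemma infsum_diff_complex:
  fixes f g :: "'a \<Rightarrow> complex"
  assumes "f summable_on X" "g summable_on X"
  shows "(\<Sum>\<^sub>\<infinity>x\<in>X. f x - g x) = infsum f X - infsum g X"
  using infsum_add[OF assms(1) summable_on_uminus[THEN iffD2, OF assms(2)]] by (simp add: infsum_uminus)

text \<open>The sets that \<open>\<sigma>\<close> eventually enters whenever they contain
  \<open>a\<close> are stable under finite intersections and arbitrary unions, so a subbasis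
  suffices. The first premise places \<open>a\<close> in the space.\<close>

lemma limitin_topology_generated_byI:
  assumes "a \<in> \<Union>\<S>" "\<And>U. U \<in> \<S> \<Longrightarrow> a \<in> U \<Longrightarrow> \<forall>\<^sub>F m in F. \<sigma> m \<in> U"
  shows "limitin (topology_generated_by \<S>) \<sigma> a F"
proof -
  have "\<forall>\<^sub>F m in F. \<sigma> m \<in> U" if "generate_topology_on \<S> U" "a \<in> U" for U
    using that
  proof induction
    case (UN K)
    then obtain V where "V \<in> K" "a \<in> V" by blast
    with UN.IH[of V] show ?case by (auto elim!: eventually_mono)
  qed (use assms(2) in \<open>auto intro: eventually_conj\<close>)
  then show ?thesis
    using assms(1) by (simp add: limitin_def openin_topology_generated_by_iff)
qed

text \<open>The preimage of \<open>UNIV\<close> under any one functional is already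
  \<open>B\<close>. An empty family would generate the topology on the empty space, hence the
  nonemptiness lemmas below.\<close>

lemma topspace_initial_topology:
  assumes "\<Phi> \<noteq> {}"
  shows "topspace (initial_topology B \<Phi>) = B"
proof -
  obtain \<phi> where "\<phi> \<in> \<Phi>"
    using assms by blast
  then have "{A \<in> B. \<phi> A \<in> UNIV} \<in> {{A \<in> B. \<phi> A \<in> U} | \<phi> U. \<phi> \<in> \<Phi> \<and> open U}"
    by blast
  then show ?thesis
    unfolding initial_topology_def topology_generated_by_topspace by auto
qed

lemma continuous_map_initial_topology:
  assumes "\<phi> \<in> \<Phi>"
  shows "continuous_map (initial_topology B \<Phi>) euclidean \<phi>"
proof -
  have "topspace (initial_topology B \<Phi>) = B"
    using topspace_initial_topology assms by blast
  then show ?thesis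
    using assms unfolding continuous_map_def initial_topology_def
    by (auto intro!: topology_generated_by_Basis)
qed

lemma limitin_initial_topologyI:
  assumes "\<Phi> \<noteq> {}" "a \<in> B" "\<And>m. \<sigma> m \<in> B" "\<And>\<phi>. \<phi> \<in> \<Phi> \<Longrightarrow> ((\<lambda>m. \<phi> (\<sigma> m)) \<longlongrightarrow> \<phi> a) F"
  shows "limitin (initial_topology B \<Phi>) \<sigma> a F"
  unfolding initial_topology_def
proof (rule limitin_topology_generated_byI)
  show "a \<in> \<Union> {{A \<in> B. \<phi> A \<in> U} | \<phi> U. \<phi> \<in> \<Phi> \<and> open U}"
    using assms(1,2) topspace_initial_topology[OF assms(1), of B]
    unfolding initial_topology_def topology_generated_by_topspace by simp
next
  fix V assume "V \<in> {{A \<in> B. \<phi> A \<in> U} | \<phi> U. \<phi> \<in> \<Phi> \<and> open U}" "a \<in> V"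
  then obtain \<phi> U where "V = {A \<in> B. \<phi> A \<in> U}" "\<phi> \<in> \<Phi>" "open U" "\<phi> a \<in> U"
    by blast
  then show "\<forall>\<^sub>F m in F. \<sigma> m \<in> V"
    using topological_tendstoD[OF assms(4)] assms(3) by simp
qed

lemma WOT_functionals_nonempty:
  "{(\<lambda>A. ell2_inner X (A f) g) | f g. f \<in> ell2 X \<and> g \<in> ell2 X} \<noteq> {}"
  using zero_ell2 by blast

lemma topspace_WOT: "topspace (WOT X) = bops X"
  unfolding WOT_def by (rule topspace_initial_topology[OF WOT_functionals_nonempty])

lemma continuous_map_WOT_entry:
  assumes "x \<in> X" "y \<in> X"
  shows "continuous_map (WOT X) euclidean (\<lambda>A. A (chi x) y)"
proof -
  have "continuous_map (WOT X) euclidean (\<lambda>A. ell2_inner X (A (chi x)) (chi y))"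
    unfolding WOT_def
    by (rule continuous_map_initial_topology) (intro CollectI exI[of _ "chi x"] exI[of _ "chi y"] conjI refl chi_in_ell2 assms)
  then show ?thesis
    by (simp add: ell2_inner_chi assms(2))
qed

lemma topspace_SOT: "topspace (SOT X) = bops X"
proof -
  have "A \<in> \<Union> {{A \<in> bops X. ell2_norm X (\<lambda>x. A f x - g x) < r} | f g r.
      f \<in> ell2 X \<and> g \<in> ell2 X \<and> r > 0}" if "A \<in> bops X" for A
  proof (rule UnionI)
    show "A \<in> {A \<in> bops X. ell2_norm X (\<lambda>x. A (\<lambda>x. 0) x - 0) < 1}"
      using that by (simp add: bops_zero)
    show "{A \<in> bops X. ell2_norm X (\<lambda>x. A (\<lambda>x. 0) x - 0) < 1} \<in>
        {{A \<in> bops X. ell2_norm X (\<lambda>x. A f x - g x) < r} | f g r.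
          f \<in> ell2 X \<and> g \<in> ell2 X \<and> r > 0}"
      using zero_ell2[of X] by (intro CollectI exI[of _ "\<lambda>x. 0"] exI[of _ 1]) simp
  qed
  then show ?thesis
    unfolding SOT_def topology_generated_by_topspace by auto
qed

text \<open>The subbasis of \<open>SOT\<close> consists of norm balls instead of preimages under
  scalar functions, so openness is checked around each point: a coordinate changes by at most the
  norm.\<close>

lemma continuous_map_SOT_entry:
  assumes "x \<in> X"
  shows "continuous_map (SOT X) euclidean (\<lambda>A. A (chi x) y)"
  unfolding continuous_map_def topspace_SOT
proof (intro conjI allI impI)
  fix U :: "complex set" assume "openin euclidean U"
  then have U: "open U" by simp
  have x: "chi x \<in> ell2 X"
    by (rule chi_in_ell2[OF assms])
  show "openin (SOT X) {A \<in> bops X. A (chi x) y \<in> U}"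
  proof (subst openin_subopen, intro ballI)
    fix A assume A: "A \<in> {A \<in> bops X. A (chi x) y \<in> U}"
    then have "A (chi x) y \<in> U"
      by simp
    then obtain r where r: "r > 0" "ball (A (chi x) y) r \<subseteq> U"
      using openE[OF U] by metis
    let ?V = "{B \<in> bops X. ell2_norm X (\<lambda>z. B (chi x) z - A (chi x) z) < r}"
    have "openin (SOT X) ?V"
      unfolding SOT_def
    proof (rule topology_generated_by_Basis, rule CollectI, rule exI[of _ "chi x"],
        rule exI[of _ "A (chi x)"], rule exI[of _ r], intro conjI)
      show "A (chi x) \<in> ell2 X"
        using A by (intro bops_ell2[OF _ x]) simp
    qed (use x r in auto)
    moreover have "A \<in> ?V"
      using A r by simp
    moreover have "?V \<subseteq> {A \<in> bops X. A (chi x) y \<in> U}"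
    proof
      fix B assume B: "B \<in> ?V"
      then have "(\<lambda>z. B (chi x) z - A (chi x) z) \<in> ell2 X"
        using A by (intro ell2_diff bops_ell2[OF _ x]) simp_all
      from norm_le_ell2_norm[OF this, of y] B have "B (chi x) y \<in> ball (A (chi x) y) r"
        by (simp add: dist_norm norm_minus_commute)
      with r B show "B \<in> {A \<in> bops X. A (chi x) y \<in> U}"
        by blast
    qed
    ultimately show "\<exists>V. openin (SOT X) V \<and> A \<in> V \<and> V \<subseteq> {A \<in> bops X. A (chi x) y \<in> U}"
      by blast
  qed
qed simp

text \<open>The rank-one operator taking \<open>chi y\<close> to \<open>chi x\<close> and every
  other basis vector to 0. Its trace pairing with \<open>A\<close> is a single matrix entry, which
  makes the entries weak-* continuous.\<close>

definition matrix_unit :: "'a set \<Rightarrow> 'a \<Rightarrow> 'a \<Rightarrow> 'a oper" where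
  "matrix_unit X x y = (\<lambda>f\<in>ell2 X. \<lambda>z. f y * chi x z)"

lemma matrix_unit_chi: "z \<in> X \<Longrightarrow> matrix_unit X x y (chi z) = (if z = y then chi x else (\<lambda>_. 0))"
  by (auto simp: matrix_unit_def chi_in_ell2 chi_eq fun_eq_iff)

lemma matrix_unit_bops:
  assumes "x \<in> X"
  shows "matrix_unit X x y \<in> bops X"
  by (rule bopsI[where M = 1])
    (use chi_in_ell2[OF assms] in \<open>auto simp: matrix_unit_def ell2_add ell2_scale ell2_norm_scale
      ell2_norm_chi[OF assms] norm_le_ell2_norm algebra_simps\<close>)

lemma matrix_unit_hilbert_schmidt:
  assumes "x \<in> X" "y \<in> X"
  shows "matrix_unit X x y \<in> hilbert_schmidt X"
proof -
  have "(\<lambda>z. (ell2_norm X (matrix_unit X x y (chi z)))\<^sup>2) summable_on {y}"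
    by simp
  then have "(\<lambda>z. (ell2_norm X (matrix_unit X x y (chi z)))\<^sup>2) summable_on X"
    by (rule summable_on_cong_neutral[THEN iffD1, rotated -1])
      (use assms in \<open>auto simp: matrix_unit_chi\<close>)
  then show ?thesis
    by (simp add: hilbert_schmidt_def matrix_unit_bops[OF assms(1)])
qed

text \<open>Membership in \<open>trace_class\<close> calls for a factorization; multiplying on the
  right by the projection \<open>matrix_unit X y y\<close> changes nothing.\<close>

lemma matrix_unit_trace_class:
  assumes "x \<in> X" "y \<in> X"
  shows "matrix_unit X x y \<in> trace_class X"
proof -
  have "matrix_unit X x y = op_mult X (matrix_unit X x y) (matrix_unit X y y)"
  proof (rule bops_eqI[of _ X])
    show "matrix_unit X x y \<in> bops X" "op_mult X (matrix_unit X x y) (matrix_unit X y y) \<in> bops X"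
      by (intro op_mult_bops matrix_unit_bops assms)+
  qed (use assms in \<open>auto simp: compose_def chi_in_ell2 matrix_unit_chi
      bops_zero[OF matrix_unit_bops]\<close>)
  then show ?thesis
    unfolding trace_class_def
    by (intro CollectI exI[of _ "matrix_unit X x y"] exI[of _ "matrix_unit X y y"] conjI
        matrix_unit_hilbert_schmidt assms)
qed

lemma trace_matrix_unit:
  assumes "A \<in> bops X" "x \<in> X" "y \<in> X"
  shows "op_trace X (op_mult X A (matrix_unit X x y)) = A (chi x) y"
proof -
  have "op_trace X (op_mult X A (matrix_unit X x y)) =
      (\<Sum>\<^sub>\<infinity>z\<in>{y}. ell2_inner X (op_mult X A (matrix_unit X x y) (chi z)) (chi z))"
    unfolding op_trace_def
    by (rule infsum_cong_neutral)
      (use assms in \<open>auto simp: compose_def chi_in_ell2 matrix_unit_chi bops_zero ell2_inner_chi\<close>)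
  then show ?thesis
    using assms by (simp add: compose_def chi_in_ell2 matrix_unit_chi ell2_inner_chi)
qed

lemma hilbert_schmidt_nonempty: "hilbert_schmidt X \<noteq> {}"
proof -
  \<comment> \<open>The zero operator serves for empty \<open>X\<close> too, where no basis vector
    is available.\<close>
  have "op_scale X 0 (op_id X) \<in> hilbert_schmidt X"
    by (auto simp: hilbert_schmidt_def op_scale_bops op_id_bops)
      (auto simp: op_scale_def chi_in_ell2 cong: summable_on_cong)
  then show ?thesis by blast
qed

lemma weak_star_functionals_nonempty:
  "{(\<lambda>A. op_trace X (op_mult X A T)) | T. T \<in> trace_class X} \<noteq> {}"
  using hilbert_schmidt_nonempty[of X] by (auto simp: trace_class_def)

lemma topspace_weak_star: "topspace (weak_star X) = bops X"
  unfolding weak_star_def by (rule topspace_initial_topology[OF weak_star_functionals_nonempty])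

lemma continuous_map_weak_star_entry:
  assumes "x \<in> X" "y \<in> X"
  shows "continuous_map (weak_star X) euclidean (\<lambda>A. A (chi x) y)"
proof (rule continuous_map_eq)
  show "continuous_map (weak_star X) euclidean (\<lambda>A. op_trace X (op_mult X A (matrix_unit X x y)))"
    unfolding weak_star_def
    by (rule continuous_map_initial_topology) (intro CollectI exI[of _ "matrix_unit X x y"] conjI refl matrix_unit_trace_class assms)
qed (simp add: topspace_weak_star trace_matrix_unit assms)

text \<open>The \<open>ell2\<close> norm of this family is the Hilbert--Schmidt norm of \<open>T\<close>.\<close>

definition column_norms :: "'a set \<Rightarrow> 'a oper \<Rightarrow> 'a \<Rightarrow> complex" where
  "column_norms X T x = (if x \<in> X then of_real (ell2_norm X (T (chi x))) else 0)"

text \<open>Turns a condition on operators into membership of a family in \<open>ell2\<close>, to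
  which Cauchy-Schwarz and dominated convergence apply.\<close>

lemma hilbert_schmidt_iff:
  "T \<in> hilbert_schmidt X \<longleftrightarrow> T \<in> bops X \<and> column_norms X T \<in> ell2 X"
  by (auto simp: hilbert_schmidt_def ell2_def column_norms_def cong: summable_on_cong)

lemma hilbert_schmidt_mult_left:
  assumes A: "A \<in> bops X" and B: "B \<in> hilbert_schmidt X"
  shows "op_mult X A B \<in> hilbert_schmidt X"
proof -
  obtain M where M: "0 \<le> M" "\<And>f. f \<in> ell2 X \<Longrightarrow> ell2_norm X (A f) \<le> M * ell2_norm X f"
    using bops_bound[OF A] by blast
  have B': "B \<in> bops X" "column_norms X B \<in> ell2 X"
    using B by (auto simp: hilbert_schmidt_iff)
  have "cmod (column_norms X (op_mult X A B) x) \<le> cmod (of_real M * column_norms X B x)" for x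
    using M B' by (simp add: column_norms_def compose_def chi_in_ell2 bops_ell2 norm_mult)
  then have "column_norms X (op_mult X A B) \<in> ell2 X"
    by (rule ell2_dominated[OF ell2_scale[OF B'(2)]])
  then show ?thesis
    by (simp add: hilbert_schmidt_iff op_mult_bops A B')
qed

text \<open>The diagonal entry of \<open>T C\<close> at \<open>x\<close> pairs row \<open>x\<close>
  of \<open>T\<close> with column \<open>x\<close> of \<open>C\<close>. One Cauchy-Schwarz bounds it
  by the product of their norms, a second one sums over \<open>x\<close>; the row norms of
  \<open>T\<close> have no larger square sum than its column norms.\<close>

lemma
  assumes T: "T \<in> hilbert_schmidt X" and C: "C \<in> hilbert_schmidt X"
  shows trace_summable: "(\<lambda>x. T (C (chi x)) x) summable_on X"
    and trace_norm_le: "cmod (\<Sum>\<^sub>\<infinity>x\<in>X. T (C (chi x)) x)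
      \<le> ell2_norm X (column_norms X T) * ell2_norm X (column_norms X C)"
proof -
  have T': "T \<in> bops X" "column_norms X T \<in> ell2 X" and C': "C \<in> bops X" "column_norms X C \<in> ell2 X"
    using T C by (auto simp: hilbert_schmidt_iff)
  \<comment> \<open>For \<open>y\<close> outside \<open>X\<close> the value \<open>T (chi y)\<close>
    is unspecified, so the row is set to 0 there.\<close>
  define row where "row x y = (if y \<in> X then T (chi y) x else 0)" for x y
  have row: "row x \<in> ell2 X" for x
  proof (rule ell2_dominated[OF T'(2)])
    show "cmod (row x y) \<le> cmod (column_norms X T y)" for y
      using norm_le_ell2_norm[OF bops_ell2[OF T'(1) chi_in_ell2]]
      by (simp add: row_def column_norms_def)
  qed
  define u where "u x = (if x \<in> X then complex_of_real (ell2_norm X (row x)) else 0)" for x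
  \<comment> \<open>Finitely many rows at a time, the row and column sums can be interchanged; the
    part of a column inside \<open>F\<close> is at most the whole column.\<close>
  have u_le: "L2_set (\<lambda>x. cmod (u x)) F \<le> ell2_norm X (column_norms X T)"
    if F: "finite F" "F \<subseteq> X" for F
  proof -
    have rows: "(\<lambda>y. (cmod (row x y))\<^sup>2) summable_on X" for x
      using row[of x] by (simp add: ell2_def)
    have "(\<Sum>x\<in>F. (cmod (u x))\<^sup>2) = (\<Sum>x\<in>F. \<Sum>\<^sub>\<infinity>y\<in>X. (cmod (row x y))\<^sup>2)"
      by (rule sum.cong) (use F in \<open>auto simp: u_def ell2_norm_power2\<close>)
    also have "\<dots> = (\<Sum>\<^sub>\<infinity>y\<in>X. \<Sum>x\<in>F. (cmod (row x y))\<^sup>2)"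
      by (rule infsum_finite_sum(1)[symmetric]) (use F rows in auto)
    also have "\<dots> \<le> (\<Sum>\<^sub>\<infinity>y\<in>X. (cmod (column_norms X T y))\<^sup>2)"
    proof (rule infsum_mono)
      show "(\<lambda>y. \<Sum>x\<in>F. (cmod (row x y))\<^sup>2) summable_on X"
        by (rule infsum_finite_sum(2)) (use F rows in auto)
      show "(\<lambda>y. (cmod (column_norms X T y))\<^sup>2) summable_on X"
        using T' by (simp add: ell2_def)
      fix y assume y: "y \<in> X"
      have "(\<Sum>x\<in>F. (cmod (T (chi y) x))\<^sup>2) \<le> (ell2_norm X (T (chi y)))\<^sup>2"
        using power_mono[OF L2_set_le_ell2_norm[OF bops_ell2[OF T'(1) chi_in_ell2[OF y]] F], of 2]
        by (simp add: L2_set_def sum_nonneg)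
      then show "(\<Sum>x\<in>F. (cmod (row x y))\<^sup>2) \<le> (cmod (column_norms X T y))\<^sup>2"
        using y by (simp add: row_def column_norms_def)
    qed
    finally show ?thesis
      by (simp add: L2_set_def ell2_norm_def)
  qed
  have u: "u \<in> ell2 X" "ell2_norm X u \<le> ell2_norm X (column_norms X T)"
    by (rule ell2_memI[OF _ u_le] ell2_norm_leI[OF _ u_le]; simp add: u_def)+
  have le: "norm (T (C (chi x)) x) \<le> norm (u x * column_norms X C x)" if x: "x \<in> X" for x
  proof -
    have Cx: "C (chi x) \<in> ell2 X"
      by (rule bops_ell2[OF C'(1) chi_in_ell2[OF x]])
    have "T (C (chi x)) x = (\<Sum>\<^sub>\<infinity>y\<in>X. C (chi x) y * T (chi y) x)"
      using bops_has_sum[OF T'(1) Cx, of x] by (simp add: infsumI)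
    also have "\<dots> = (\<Sum>\<^sub>\<infinity>y\<in>X. C (chi x) y * row x y)"
      by (rule infsum_cong) (simp add: row_def)
    also have "norm \<dots> \<le> ell2_norm X (C (chi x)) * ell2_norm X (row x)"
      by (rule ell2_Cauchy_Schwarz[OF Cx row])
    finally show ?thesis
      using x by (simp add: u_def column_norms_def norm_mult mult.commute)
  qed
  have sum: "(\<lambda>x. norm (u x * column_norms X C x)) summable_on X"
    by (rule ell2_mult_summable_norm[OF u(1) C'(2)])
  have abs: "(\<lambda>x. norm (T (C (chi x)) x)) summable_on X"
    by (rule Infinite_Sum.abs_summable_on_comparison_test'[OF sum le])
  then show "(\<lambda>x. T (C (chi x)) x) summable_on X"
    by (rule abs_summable_summable)
  have "cmod (\<Sum>\<^sub>\<infinity>x\<in>X. T (C (chi x)) x) \<le> (\<Sum>\<^sub>\<infinity>x\<in>X. norm (T (C (chi x)) x))"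
    by (rule norm_infsum_bound[OF abs])
  also have "\<dots> \<le> (\<Sum>\<^sub>\<infinity>x\<in>X. norm (u x * column_norms X C x))"
    by (rule infsum_mono[OF abs sum le])
  also have "\<dots> \<le> ell2_norm X u * ell2_norm X (column_norms X C)"
    by (rule ell2_Cauchy_Schwarz_norm[OF u(1) C'(2)])
  also have "\<dots> \<le> ell2_norm X (column_norms X T) * ell2_norm X (column_norms X C)"
    by (rule mult_right_mono[OF u(2)]) simp
  finally show "cmod (\<Sum>\<^sub>\<infinity>x\<in>X. T (C (chi x)) x)
      \<le> ell2_norm X (column_norms X T) * ell2_norm X (column_norms X C)" .
qed

text \<open>Regroups \<open>A (B C)\<close> as \<open>(A B) C\<close>, so that the varying factor
  \<open>A\<close> is absorbed into a Hilbert-Schmidt operator and \<open>trace_norm_le\<close>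
  applies.\<close>

lemma op_trace_mult:
  "op_trace X (op_mult X A (op_mult X B C)) = (\<Sum>\<^sub>\<infinity>x\<in>X. op_mult X A B (C (chi x)) x)"
  if "C \<in> bops X"
  unfolding op_trace_def
  by (rule infsum_cong) (use that in \<open>auto simp: ell2_inner_chi compose_def chi_in_ell2 bops_ell2\<close>)

text \<open>Density argument: the bound \<open>K\<close>, uniform in \<open>m\<close>, controls the
  tail of \<open>f\<close>, and the remaining part is a finite combination of basis vectors.\<close>

lemma strong_convergence_from_basis:
  assumes D: "\<And>m. D m \<in> bops X"
    and K: "0 \<le> K" "\<And>m f. f \<in> ell2 X \<Longrightarrow> ell2_norm X (D m f) \<le> K * ell2_norm X f"
    and lim: "\<And>x. x \<in> X \<Longrightarrow> (\<lambda>m. ell2_norm X (D m (chi x))) \<longlonglongrightarrow> 0"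
    and f: "f \<in> ell2 X"
  shows "(\<lambda>m. ell2_norm X (D m f)) \<longlonglongrightarrow> 0"
proof (rule LIMSEQ_I)
  fix \<epsilon> :: real assume "0 < \<epsilon>"
  \<comment> \<open>\<open>K + 1\<close> keeps the denominator positive when
    \<open>K = 0\<close>.\<close>
  then have "0 < \<epsilon> / (2 * (K + 1))"
    using K by simp
  then obtain E where E: "finite E" "E \<subseteq> X"
    "ell2_norm X (\<lambda>x. if x \<in> E then 0 else f x) < \<epsilon> / (2 * (K + 1))"
    by (rule ell2_obtain_cutoff[OF f])
  let ?p = "\<lambda>x. if x \<in> E then f x else 0" and ?q = "\<lambda>x. if x \<in> E then 0 else f x"
  have q: "?q \<in> ell2 X"
    by (rule ell2_dominated[OF f]) auto
  have p: "?p \<in> ell2 X"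
    by (rule ell2_cutoff[OF f])
  have tail: "K * ell2_norm X ?q \<le> \<epsilon> / 2"
  proof -
    have "K * ell2_norm X ?q \<le> (K + 1) * (\<epsilon> / (2 * (K + 1)))"
      using E(3) K by (intro mult_mono) auto
    also have "\<dots> = \<epsilon> / 2"
      using K by (simp add: field_simps)
    finally show ?thesis .
  qed
  have bound: "ell2_norm X (D m f) \<le> (\<Sum>y\<in>E. cmod (f y) * ell2_norm X (D m (chi y))) + \<epsilon> / 2" for m
  proof -
    have "D m f = (\<lambda>x. D m ?p x + D m ?q x)"
      by (simp add: bops_diff_cutoff[OF D f])
    then have "ell2_norm X (D m f) \<le> ell2_norm X (D m ?p) + ell2_norm X (D m ?q)"
      using ell2_norm_triangle[OF bops_ell2[OF D p] bops_ell2[OF D q]] by simp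
    also have "ell2_norm X (D m ?p) \<le> (\<Sum>y\<in>E. ell2_norm X (\<lambda>x. f y * D m (chi y) x))"
      unfolding bops_cutoff[OF D E(1,2)]
      by (rule ell2_norm_sum_le[OF E(1)])
        (use E in \<open>auto intro!: ell2_scale bops_ell2[OF D] chi_in_ell2\<close>)
    also have "\<dots> = (\<Sum>y\<in>E. cmod (f y) * ell2_norm X (D m (chi y)))"
      by (simp add: ell2_norm_scale)
    finally show ?thesis
      using K(2)[OF q, of m] tail by linarith
  qed
  have "(\<lambda>m. \<Sum>y\<in>E. cmod (f y) * ell2_norm X (D m (chi y))) \<longlonglongrightarrow> (\<Sum>y\<in>E. cmod (f y) * 0)"
    by (intro tendsto_intros lim) (use E in auto)
  then have "\<forall>\<^sub>F m in sequentially. (\<Sum>y\<in>E. cmod (f y) * ell2_norm X (D m (chi y))) < \<epsilon> / 2"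
    using \<open>0 < \<epsilon>\<close> by (intro order_tendstoD(2)[where y = 0]) auto
  then obtain m0 where m0:
    "\<And>m. m \<ge> m0 \<Longrightarrow> (\<Sum>y\<in>E. cmod (f y) * ell2_norm X (D m (chi y))) < \<epsilon> / 2"
    by (auto simp: eventually_sequentially)
  have "norm (ell2_norm X (D m f) - 0) < \<epsilon>" if "m \<ge> m0" for m
    using bound[of m] m0[OF that] by simp
  then show "\<exists>m0. \<forall>m\<ge>m0. norm (ell2_norm X (D m f) - 0) < \<epsilon>"
    by blast
qed

section \<open>From strong convergence to limits in the three topologies\<close>

context
  fixes X :: "'a set" and \<sigma> :: "nat \<Rightarrow> 'a oper" and A :: "'a oper"
  assumes \<sigma>: "\<And>m. \<sigma> m \<in> bops X" and A: "A \<in> bops X"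
    and lim: "\<And>f. f \<in> ell2 X \<Longrightarrow> (\<lambda>m. ell2_norm X (\<lambda>x. \<sigma> m f x - A f x)) \<longlonglongrightarrow> 0"
begin

text \<open>Subbasic balls may be centred at any \<open>g\<close>; the error only has to fall below
  the slack that \<open>A\<close> itself leaves in the radius \<open>r\<close>.\<close>

lemma limitin_SOT: "limitin (SOT X) \<sigma> A sequentially"
  unfolding SOT_def
proof (rule limitin_topology_generated_byI)
  show "A \<in> \<Union> {{A \<in> bops X. ell2_norm X (\<lambda>x. A f x - g x) < r} | f g r.
      f \<in> ell2 X \<and> g \<in> ell2 X \<and> r > 0}"
    using A topspace_SOT[of X] unfolding SOT_def topology_generated_by_topspace by simp
next
  fix U assume "U \<in> {{A \<in> bops X. ell2_norm X (\<lambda>x. A f x - g x) < r} | f g r.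
      f \<in> ell2 X \<and> g \<in> ell2 X \<and> r > 0}" "A \<in> U"
  then obtain f g r where U: "U = {A \<in> bops X. ell2_norm X (\<lambda>x. A f x - g x) < r}"
    and fg: "f \<in> ell2 X" "g \<in> ell2 X" and less: "ell2_norm X (\<lambda>x. A f x - g x) < r"
    by blast
  have "\<forall>\<^sub>F m in sequentially. ell2_norm X (\<lambda>x. \<sigma> m f x - A f x) < r - ell2_norm X (\<lambda>x. A f x - g x)"
    using order_tendstoD(2)[OF lim[OF fg(1)]] less by simp
  then show "\<forall>\<^sub>F m in sequentially. \<sigma> m \<in> U"
  proof eventually_elim
    case (elim m)
    have "ell2_norm X (\<lambda>x. \<sigma> m f x - g x) \<le>
        ell2_norm X (\<lambda>x. \<sigma> m f x - A f x) + ell2_norm X (\<lambda>x. A f x - g x)"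
      using ell2_norm_triangle[OF ell2_diff[OF bops_ell2[OF \<sigma>[of m] fg(1)] bops_ell2[OF A fg(1)]]
          ell2_diff[OF bops_ell2[OF A fg(1)] fg(2)]] by simp
    with elim show ?case by (simp add: U \<sigma>)
  qed
qed

lemma limitin_WOT: "limitin (WOT X) \<sigma> A sequentially"
  unfolding WOT_def
proof (rule limitin_initial_topologyI[OF WOT_functionals_nonempty A \<sigma>])
  fix \<phi> assume "\<phi> \<in> {(\<lambda>A. ell2_inner X (A f) g) | f g. f \<in> ell2 X \<and> g \<in> ell2 X}"
  then obtain f g where \<phi>: "\<phi> = (\<lambda>A. ell2_inner X (A f) g)" and fg: "f \<in> ell2 X" "g \<in> ell2 X"
    by blast
  have sum: "(\<lambda>x. T f x * cnj (g x)) summable_on X" if "T \<in> bops X" for T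
    by (rule abs_summable_summable[OF ell2_mult_summable_norm[OF bops_ell2[OF that fg(1)]
      ell2_cnj[OF fg(2)]]])
  have le: "norm (\<phi> (\<sigma> m) - \<phi> A) \<le> ell2_norm X (\<lambda>x. \<sigma> m f x - A f x) * ell2_norm X g" for m
  proof -
    have "\<phi> (\<sigma> m) - \<phi> A = (\<Sum>\<^sub>\<infinity>x\<in>X. \<sigma> m f x * cnj (g x) - A f x * cnj (g x))"
      unfolding \<phi> ell2_inner_def by (rule infsum_diff_complex[symmetric]) (intro sum \<sigma> A)+
    also have "\<dots> = (\<Sum>\<^sub>\<infinity>x\<in>X. (\<sigma> m f x - A f x) * cnj (g x))"
      by (simp add: left_diff_distrib)
    also have "norm \<dots> \<le> ell2_norm X (\<lambda>x. \<sigma> m f x - A f x) * ell2_norm X (\<lambda>x. cnj (g x))"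
      by (intro ell2_Cauchy_Schwarz ell2_diff bops_ell2[OF \<sigma>] bops_ell2[OF A] ell2_cnj fg)
    finally show ?thesis by (simp add: ell2_norm_cnj)
  qed
  show "(\<lambda>m. \<phi> (\<sigma> m)) \<longlonglongrightarrow> \<phi> A"
    by (rule LIM_zero_cancel[OF Lim_null_comparison[OF always_eventually[OF allI[OF le]]
            tendsto_mult_left_zero[OF lim[OF fg(1)]]]])
qed

text \<open>Column \<open>x\<close> of \<open>(\<sigma> m - A) B\<close> tends to 0 by strong
  convergence and is dominated through \<open>K\<close> by column \<open>x\<close> of
  \<open>B\<close>. Dominated convergence sends the Hilbert-Schmidt norm of the product to 0, and
  the trace inequality against \<open>C\<close> concludes.\<close>

lemma limitin_weak_star:
  assumes K: "\<And>m f. f \<in> ell2 X \<Longrightarrow> ell2_norm X (\<lambda>x. \<sigma> m f x - A f x) \<le> K * ell2_norm X f"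
  shows "limitin (weak_star X) \<sigma> A sequentially"
  unfolding weak_star_def
proof (rule limitin_initial_topologyI[OF weak_star_functionals_nonempty A \<sigma>])
  fix \<phi> assume "\<phi> \<in> {(\<lambda>A. op_trace X (op_mult X A T)) | T. T \<in> trace_class X}"
  then obtain B C where B: "B \<in> hilbert_schmidt X" and C: "C \<in> hilbert_schmidt X"
    and \<phi>: "\<phi> = (\<lambda>A. op_trace X (op_mult X A (op_mult X B C)))"
    by (auto simp: trace_class_def)
  have B': "B \<in> bops X" "column_norms X B \<in> ell2 X" and C': "C \<in> bops X"
    using B C by (auto simp: hilbert_schmidt_iff)
  define D where "D m = op_add X (\<sigma> m) (op_scale X (-1) A)" for m
  have D: "D m \<in> bops X" for m
    unfolding D_def by (intro op_add_bops op_scale_bops \<sigma> A)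
  have D_apply: "D m f = (\<lambda>x. \<sigma> m f x - A f x)" if "f \<in> ell2 X" for m f
    using that by (simp add: D_def op_add_def op_scale_def)
  let ?b = "\<lambda>m. ell2_norm X (column_norms X (op_mult X (D m) B))"
  have le: "norm (\<phi> (\<sigma> m) - \<phi> A) \<le> ?b m * ell2_norm X (column_norms X C)" for m
  proof -
    have "\<phi> (\<sigma> m) - \<phi> A = (\<Sum>\<^sub>\<infinity>x\<in>X. op_mult X (\<sigma> m) B (C (chi x)) x - op_mult X A B (C (chi x)) x)"
      unfolding \<phi> op_trace_mult[OF C']
      by (rule infsum_diff_complex[symmetric]) (intro trace_summable hilbert_schmidt_mult_left \<sigma> A B C)+
    also have "\<dots> = (\<Sum>\<^sub>\<infinity>x\<in>X. op_mult X (D m) B (C (chi x)) x)"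
      by (rule infsum_cong)
        (use B' C' in \<open>simp add: compose_def D_apply bops_ell2 chi_in_ell2\<close>)
    also have "norm \<dots> \<le> ?b m * ell2_norm X (column_norms X C)"
      by (intro trace_norm_le hilbert_schmidt_mult_left D B C)
    finally show ?thesis .
  qed
  have "?b \<longlonglongrightarrow> 0"
  proof (rule ell2_dominated_convergence)
    show "(\<lambda>x. of_real \<bar>K\<bar> * column_norms X B x) \<in> ell2 X"
      by (rule ell2_scale[OF B'(2)])
    fix m x
    show "cmod (column_norms X (op_mult X (D m) B) x) \<le> cmod (of_real \<bar>K\<bar> * column_norms X B x)"
    proof (cases "x \<in> X")
      case True
      then have Bx: "B (chi x) \<in> ell2 X"
        by (intro bops_ell2[OF B'(1)] chi_in_ell2)
      have "ell2_norm X (\<lambda>z. \<sigma> m (B (chi x)) z - A (B (chi x)) z) \<le> \<bar>K\<bar> * ell2_norm X (B (chi x))"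
        by (rule order_trans[OF K[OF Bx]]) (simp add: mult_right_mono)
      with True Bx show ?thesis
        by (simp add: column_norms_def compose_def chi_in_ell2 D_apply norm_mult)
    qed (simp add: column_norms_def)
  next
    fix x assume x: "x \<in> X"
    then have Bx: "B (chi x) \<in> ell2 X"
      by (intro bops_ell2[OF B'(1)] chi_in_ell2)
    show "(\<lambda>m. column_norms X (op_mult X (D m) B) x) \<longlonglongrightarrow> 0"
      using tendsto_of_real[OF lim[OF Bx], where 'a = complex] x Bx
      by (simp add: column_norms_def compose_def chi_in_ell2 D_apply)
  qed
  then have "(\<lambda>m. ?b m * ell2_norm X (column_norms X C)) \<longlonglongrightarrow> 0"
    by (rule tendsto_mult_left_zero)
  then show "(\<lambda>m. \<phi> (\<sigma> m)) \<longlonglongrightarrow> \<phi> A"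
    by (rule LIM_zero_cancel[OF Lim_null_comparison[OF always_eventually[OF allI[OF le]]]])
qed

end

lemma sequential_closure_subset_closure_of:
  "sequential_closure_of \<tau> S \<subseteq> \<tau> closure_of S"
proof
  fix a assume "a \<in> sequential_closure_of \<tau> S"
  then obtain \<sigma> where \<sigma>: "\<And>m. \<sigma> m \<in> S" "limitin \<tau> \<sigma> a sequentially"
    by (auto simp: sequential_closure_of_def)
  show "a \<in> \<tau> closure_of S"
    unfolding in_closure_of
  proof (intro conjI allI impI)
    show "a \<in> topspace \<tau>"
      using \<sigma>(2) by (simp add: limitin_def)
    fix U assume "a \<in> U \<and> openin \<tau> U"
    then have "\<forall>\<^sub>F m in sequentially. \<sigma> m \<in> U"
      using \<sigma>(2) by (simp add: limitin_def)
    then show "\<exists>y. y \<in> S \<and> y \<in> U"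
      using \<sigma>(1) eventually_happens'[OF sequentially_bot] by fastforce
  qed
qed

section \<open>Twisted shifts and the Hardy space\<close>

definition mconc :: "mword \<Rightarrow> mword \<Rightarrow> mword" where
  "mconc \<beta> \<gamma> = (\<lambda>i. \<beta> i @ \<gamma> i)"

definition mempty :: mword where
  "mempty = (\<lambda>_. [])"

definition mlen :: "nat \<Rightarrow> mword \<Rightarrow> nat" where
  "mlen k \<alpha> = (\<Sum>i\<in>{1..k}. length (\<alpha> i))"

definition pair_lam :: "lam \<Rightarrow> nat \<Rightarrow> nat \<Rightarrow> nat list \<Rightarrow> nat list \<Rightarrow> complex" where
  "pair_lam lam i j \<alpha> \<beta> = prod_list (map (\<lambda>s. word_lam lam i j s \<beta>) \<alpha>)"

text \<open>This is \<omega> of the overview; \<open>pair_lam\<close> collects one matrix entry for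
  each pair of a letter of \<open>\<beta> i\<close> and a letter of
  \<open>\<gamma> j\<close>.\<close>

definition phase :: "nat \<Rightarrow> lam \<Rightarrow> mword \<Rightarrow> mword \<Rightarrow> complex" where
  "phase k lam \<beta> \<gamma> = (\<Prod>i\<in>{1..k}. \<Prod>j\<in>{1..<i}. pair_lam lam i j (\<beta> i) (\<gamma> j))"

lemma mconc_mwords: "\<beta> \<in> mwords k n \<Longrightarrow> \<gamma> \<in> mwords k n \<Longrightarrow> mconc \<beta> \<gamma> \<in> mwords k n"
  by (auto simp: mwords_def mconc_def)

lemma mempty_mwords: "mempty \<in> mwords k n"
  by (simp add: mwords_def mempty_def)

lemma inj_on_mconc: "inj_on (\<lambda>\<beta>. mconc \<beta> \<gamma>) X"
  by (auto simp: inj_on_def mconc_def fun_eq_iff)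

lemma mconc_mempty [simp]: "mconc \<beta> mempty = \<beta>" "mconc mempty \<gamma> = \<gamma>"
  by (simp_all add: mconc_def mempty_def)

lemma mlen_mconc: "mlen k (mconc \<beta> \<gamma>) = mlen k \<beta> + mlen k \<gamma>"
  by (simp add: mlen_def mconc_def sum.distrib)

text \<open>Finiteness of the alphabets is what makes the Fejer means polynomials.\<close>

lemma finite_mwords_mlen_le: "finite {\<beta> \<in> mwords k n. mlen k \<beta> \<le> N}"
proof -
  \<comment> \<open>One finite set containing the possible words of all components, so that
    finiteness of a function space with common range applies.\<close>
  let ?B = "\<Union>i\<in>{1..k}. {xs. set xs \<subseteq> {1..n i} \<and> length xs \<le> N}"
  have "{\<beta> \<in> mwords k n. mlen k \<beta> \<le> N} \<subseteq>
      {\<beta>. \<forall>i. (i \<in> {1..k} \<longrightarrow> \<beta> i \<in> ?B) \<and> (i \<notin> {1..k} \<longrightarrow> \<beta> i = [])}"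
  proof safe
    fix \<beta> i assume \<beta>: "\<beta> \<in> mwords k n" "mlen k \<beta> \<le> N" and i: "i \<in> {1..k}"
    have "length (\<beta> i) \<le> mlen k \<beta>"
      unfolding mlen_def using i by (intro member_le_sum) auto
    then show "\<beta> i \<in> ?B"
      using \<beta> i by (force simp: mwords_def)
  qed (auto simp: mwords_def)
  moreover have "finite {\<beta>. \<forall>i. (i \<in> {1..k} \<longrightarrow> \<beta> i \<in> ?B) \<and> (i \<notin> {1..k} \<longrightarrow> \<beta> i = [])}"
    by (intro finite_set_of_finite_funs finite_UN_I finite_lists_length_le) auto
  ultimately show ?thesis
    by (rule finite_subset)
qed

lemma word_lam_append: "word_lam lam i j s (\<beta> @ \<gamma>) = word_lam lam i j s \<beta> * word_lam lam i j s \<gamma>"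
  by (simp add: word_lam_def)

lemma word_lam_Nil [simp]: "word_lam lam i j s [] = 1"
  by (simp add: word_lam_def)

lemma pair_lam_Nil_left [simp]: "pair_lam lam i j [] \<beta> = 1"
  by (simp add: pair_lam_def)

lemma pair_lam_Cons: "pair_lam lam i j (s # \<alpha>) \<beta> = word_lam lam i j s \<beta> * pair_lam lam i j \<alpha> \<beta>"
  by (simp add: pair_lam_def)

lemma pair_lam_Nil_right [simp]: "pair_lam lam i j \<alpha> [] = 1"
  by (induction \<alpha>) (simp_all add: pair_lam_Cons)

lemma phase_mempty_right [simp]: "phase k lam \<beta> mempty = 1"
  by (simp add: phase_def mempty_def)

lemma phase_mempty_left [simp]: "phase k lam mempty \<gamma> = 1"
  by (simp add: phase_def mempty_def)

text \<open>Only the factor of index \<open>i\<close> changes, and the scalar split off is the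
  weight of the left shift at \<open>\<gamma>\<close>. This identity is behind the commutation of
  left and right shifts.\<close>

lemma phase_Cons:
  assumes "i \<in> {1..k}"
  shows "phase k lam (\<beta>(i := s # \<beta> i)) \<gamma> =
    (\<Prod>j\<in>{1..<i}. word_lam lam i j s (\<gamma> j)) * phase k lam \<beta> \<gamma>"
proof -
  let ?P = "\<lambda>\<beta> i. \<Prod>j\<in>{1..<i}. pair_lam lam i j (\<beta> i) (\<gamma> j)"
  have "phase k lam (\<beta>(i := s # \<beta> i)) \<gamma> =
      ?P (\<beta>(i := s # \<beta> i)) i * prod (?P (\<beta>(i := s # \<beta> i))) ({1..k} - {i})"
    unfolding phase_def by (rule prod.remove) (use assms in auto)
  also have "prod (?P (\<beta>(i := s # \<beta> i))) ({1..k} - {i}) = prod (?P \<beta>) ({1..k} - {i})"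
    by (rule prod.cong) auto
  also have "?P (\<beta>(i := s # \<beta> i)) i = (\<Prod>j\<in>{1..<i}. word_lam lam i j s (\<gamma> j)) * ?P \<beta> i"
    by (simp add: pair_lam_Cons prod.distrib)
  also have "\<dots> * prod (?P \<beta>) ({1..k} - {i}) =
      (\<Prod>j\<in>{1..<i}. word_lam lam i j s (\<gamma> j)) * (?P \<beta> i * prod (?P \<beta>) ({1..k} - {i}))"
    by (simp only: mult.assoc)
  also have "?P \<beta> i * prod (?P \<beta>) ({1..k} - {i}) = phase k lam \<beta> \<gamma>"
    unfolding phase_def by (rule prod.remove[symmetric]) (use assms in auto)
  finally show ?thesis .
qed

locale twisted_shifts =
  fixes k :: nat and n :: "nat \<Rightarrow> nat" and lam :: lam
  assumes unimodular: "\<And>i j s t. i \<in> {1..k} \<Longrightarrow> j \<in> {1..<i} \<Longrightarrow> s \<in> {1..n i} \<Longrightarrow> t \<in> {1..n j} \<Longrightarrow>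
    cmod (lam i j s t) = 1"
begin

abbreviation W :: "mword set" where
  "W \<equiv> mwords k n"

lemma norm_word_lam:
  assumes "i \<in> {1..k}" "j \<in> {1..<i}" "s \<in> {1..n i}" "\<beta> \<in> lists {1..n j}"
  shows "cmod (word_lam lam i j s \<beta>) = 1"
  using assms(4) by induction (use unimodular[OF assms(1-3)] in \<open>auto simp: word_lam_def norm_mult\<close>)

lemma norm_pair_lam:
  assumes "i \<in> {1..k}" "j \<in> {1..<i}" "\<alpha> \<in> lists {1..n i}" "\<beta> \<in> lists {1..n j}"
  shows "cmod (pair_lam lam i j \<alpha> \<beta>) = 1"
  using assms(3)
  by induction (use norm_word_lam[OF assms(1,2) _ assms(4)] in \<open>auto simp: pair_lam_Cons norm_mult\<close>)

lemma mwords_nth: "\<beta> \<in> W \<Longrightarrow> i \<in> {1..k} \<Longrightarrow> \<beta> i \<in> lists {1..n i}"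
  by (simp add: mwords_def)

lemma norm_phase:
  assumes "\<beta> \<in> W" "\<gamma> \<in> W"
  shows "cmod (phase k lam \<beta> \<gamma>) = 1"
proof -
  have "cmod (pair_lam lam i j (\<beta> i) (\<gamma> j)) = 1" if "i \<in> {1..k}" "j \<in> {1..<i}" for i j
    using that assms by (intro norm_pair_lam mwords_nth) auto
  then show ?thesis
    by (simp add: phase_def flip: prod_norm)
qed

lemma mwords_Cons: "\<alpha> \<in> W \<Longrightarrow> i \<in> {1..k} \<Longrightarrow> s \<in> {1..n i} \<Longrightarrow> \<alpha>(i := s # \<alpha> i) \<in> W"
  by (auto simp: mwords_def)

lemma shift_eq_weighted_shift:
  "shift k n lam i s = weighted_shift W (\<lambda>\<alpha>. \<alpha>(i := s # \<alpha> i))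
     (\<lambda>\<alpha>. \<Prod>j\<in>{1..<i}. word_lam lam i j s (\<alpha> j))"
  by (simp add: shift_def weighted_shift_def shift_basis_def)

lemma shift_bops:
  assumes "i \<in> {1..k}" "s \<in> {1..n i}"
  shows "shift k n lam i s \<in> bops W"
  unfolding shift_eq_weighted_shift
proof (rule weighted_shift_bops)
  show "inj_on (\<lambda>\<alpha>. \<alpha>(i := s # \<alpha> i)) W"
  proof (rule inj_onI)
    fix \<alpha> \<beta> :: mword assume eq: "\<alpha>(i := s # \<alpha> i) = \<beta>(i := s # \<beta> i)"
    show "\<alpha> = \<beta>"
    proof
      fix j show "\<alpha> j = \<beta> j"
        using fun_cong[OF eq, of j] by (cases "j = i") auto
    qed
  qed
  show "(\<lambda>\<alpha>. \<alpha>(i := s # \<alpha> i)) ` W \<subseteq> W"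
    using mwords_Cons assms by blast
  fix \<alpha> assume "\<alpha> \<in> W"
  then have "cmod (word_lam lam i j s (\<alpha> j)) = 1" if "j \<in> {1..<i}" for j
    using that assms by (intro norm_word_lam mwords_nth) auto
  then show "cmod (\<Prod>j\<in>{1..<i}. word_lam lam i j s (\<alpha> j)) \<le> 1"
    by (simp flip: prod_norm)
qed

lemma polynomials_bops: "T \<in> polynomials k n lam \<Longrightarrow> T \<in> bops W"
  unfolding polynomials_def by (rule op_algebra_bops[rotated]) (auto intro: shift_bops)

lemma shift_word_Nil: "shift_word k n lam i [] = op_id W"
  by (simp add: shift_word_def)

lemma shift_word_Cons:
  "shift_word k n lam i (s # \<alpha>) = op_mult W (shift k n lam i s) (shift_word k n lam i \<alpha>)"
  by (simp add: shift_word_def)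

lemma shift_word_polynomials:
  assumes "i \<in> {1..k}" "\<alpha> \<in> lists {1..n i}"
  shows "shift_word k n lam i \<alpha> \<in> polynomials k n lam"
  using assms(2)
proof induction
  case Nil
  then show ?case
    unfolding shift_word_Nil polynomials_def by (rule op_algebra.one)
next
  case (Cons s \<alpha>)
  then have "shift k n lam i s \<in> polynomials k n lam"
    using assms(1) unfolding polynomials_def by (intro op_algebra.gen) auto
  with Cons show ?case
    unfolding shift_word_Cons polynomials_def by (intro op_algebra.mult)
qed

text \<open>Each letter lengthens component \<open>i\<close> but reads only the components below it,
  which stay those of \<open>\<gamma>\<close>; the weights therefore multiply up to
  \<open>pair_lam\<close>. Membership is carried through the induction because
  \<open>shift_chi\<close> needs it.\<close>

lemma shift_word_chi:
  assumes i: "i \<in> {1..k}" and \<alpha>: "\<alpha> \<in> lists {1..n i}" and \<gamma>: "\<gamma> \<in> W"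
  shows "\<gamma>(i := \<alpha> @ \<gamma> i) \<in> W"
    and "shift_word k n lam i \<alpha> (chi \<gamma>) =
      (\<lambda>\<delta>. (\<Prod>j\<in>{1..<i}. pair_lam lam i j \<alpha> (\<gamma> j)) * chi (\<gamma>(i := \<alpha> @ \<gamma> i)) \<delta>)"
proof -
  have "\<gamma>(i := \<alpha> @ \<gamma> i) \<in> W \<and> shift_word k n lam i \<alpha> (chi \<gamma>) =
      (\<lambda>\<delta>. (\<Prod>j\<in>{1..<i}. pair_lam lam i j \<alpha> (\<gamma> j)) * chi (\<gamma>(i := \<alpha> @ \<gamma> i)) \<delta>)"
    using \<alpha>
  proof induction
    case Nil
    then show ?case
      using \<gamma> by (simp add: shift_word_Nil op_id_def chi_in_ell2)
  next
    case (Cons s \<alpha>)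
    let ?\<gamma> = "\<gamma>(i := \<alpha> @ \<gamma> i)" and ?c = "\<Prod>j\<in>{1..<i}. pair_lam lam i j \<alpha> (\<gamma> j)"
    have \<gamma>': "?\<gamma> \<in> W"
      using Cons by blast
    have "?\<gamma>(i := s # ?\<gamma> i) \<in> W"
      by (rule mwords_Cons[OF \<gamma>' i]) (use Cons in auto)
    then have mem: "\<gamma>(i := (s # \<alpha>) @ \<gamma> i) \<in> W"
      by simp
    have "shift_word k n lam i (s # \<alpha>) (chi \<gamma>) =
        shift k n lam i s (shift_word k n lam i \<alpha> (chi \<gamma>))"
      using \<gamma> by (simp add: shift_word_Cons compose_def chi_in_ell2)
    also have "shift_word k n lam i \<alpha> (chi \<gamma>) = (\<lambda>\<delta>. ?c * chi ?\<gamma> \<delta>)"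
      using Cons.IH by blast
    also have "shift k n lam i s (\<lambda>\<delta>. ?c * chi ?\<gamma> \<delta>) = (\<lambda>\<delta>. ?c * shift k n lam i s (chi ?\<gamma>) \<delta>)"
      by (rule bops_scale[OF shift_bops[OF i] chi_in_ell2[OF \<gamma>']]) (use Cons in auto)
    also have "shift k n lam i s (chi ?\<gamma>) =
        (\<lambda>\<delta>. (\<Prod>j\<in>{1..<i}. word_lam lam i j s (\<gamma> j)) * chi (\<gamma>(i := (s # \<alpha>) @ \<gamma> i)) \<delta>)"
      by (simp add: shift_chi[OF \<gamma>'] shift_basis_def)
    finally have "shift_word k n lam i (s # \<alpha>) (chi \<gamma>) =
        (\<lambda>\<delta>. (\<Prod>j\<in>{1..<i}. pair_lam lam i j (s # \<alpha>) (\<gamma> j)) * chi (\<gamma>(i := (s # \<alpha>) @ \<gamma> i)) \<delta>)"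
      by (simp add: pair_lam_Cons prod.distrib mult_ac)
    with mem show ?case
      by (rule conjI)
  qed
  then show "\<gamma>(i := \<alpha> @ \<gamma> i) \<in> W" "shift_word k n lam i \<alpha> (chi \<gamma>) =
      (\<lambda>\<delta>. (\<Prod>j\<in>{1..<i}. pair_lam lam i j \<alpha> (\<gamma> j)) * chi (\<gamma>(i := \<alpha> @ \<gamma> i)) \<delta>)"
    by auto
qed

lemma shift_mword_polynomials:
  assumes "\<beta> \<in> W"
  shows "shift_mword k n lam \<beta> \<in> polynomials k n lam"
proof -
  have fold: "foldr (\<lambda>i T. op_mult W (shift_word k n lam i (\<beta> i)) T) is (op_id W) \<in> polynomials k n lam"
    if "set is \<subseteq> {1..k}" for "is"
    using that
  proof (induction "is")
    case Nil
    then show ?case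
      unfolding polynomials_def by (simp add: op_algebra.one)
  next
    case (Cons i "is")
    then have "shift_word k n lam i (\<beta> i) \<in> polynomials k n lam"
      using assms by (intro shift_word_polynomials mwords_nth) auto
    with Cons show ?case
      unfolding polynomials_def by (simp add: op_algebra.mult)
  qed
  show ?thesis
    unfolding shift_mword_def by (rule fold) auto
qed

text \<open>
  The factors act from \<open>k\<close> down to \<open>1\<close>, and the \<open>i\<close>-th one only reads the components below \<open>i\<close>,
  which are still those of \<open>\<gamma>\<close>; hence the phase is a product over pairs \<open>j < i\<close>.
\<close>

lemma shift_mword_chi:
  assumes \<beta>: "\<beta> \<in> W" and \<gamma>: "\<gamma> \<in> W"
  shows "shift_mword k n lam \<beta> (chi \<gamma>) = (\<lambda>\<delta>. phase k lam \<beta> \<gamma> * chi (mconc \<beta> \<gamma>) \<delta>)"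
proof -
  \<comment> \<open>Product of the factors \<open>m\<close> to \<open>k\<close>, followed by the
    multiword and the scalar it produces; the induction descends from the empty product at
    \<open>m = Suc k\<close>.\<close>
  let ?T = "\<lambda>m. foldr (\<lambda>i T. op_mult W (shift_word k n lam i (\<beta> i)) T) [m..<Suc k] (op_id W)"
  let ?\<gamma> = "\<lambda>m i. if m \<le> i then \<beta> i @ \<gamma> i else \<gamma> i"
  let ?c = "\<lambda>m. \<Prod>i\<in>{m..k}. \<Prod>j\<in>{1..<i}. pair_lam lam i j (\<beta> i) (\<gamma> j)"
  have mem: "?\<gamma> m \<in> W" for m
    using \<beta> \<gamma> by (auto simp: mwords_def)
  have "?T m (chi \<gamma>) = (\<lambda>\<delta>. ?c m * chi (?\<gamma> m) \<delta>)" if "1 \<le> m" "m \<le> Suc k" for m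
    using that(2,1)
  proof (induction m rule: inc_induct)
    case base
    \<comment> \<open>Indices beyond \<open>k\<close> still satisfy the test, but there
      \<open>\<beta>\<close> is the empty word.\<close>
    have "?\<gamma> (Suc k) = \<gamma>"
      using \<beta> by (auto simp: mwords_def)
    then show ?case
      using \<gamma> by (simp add: op_id_def chi_in_ell2)
  next
    case (step m)
    then have m: "m \<in> {1..k}"
      by auto
    have "\<beta> m \<in> lists {1..n m}"
      by (rule mwords_nth[OF \<beta> m])
    note word = shift_word_chi(2)[OF m this mem[of "Suc m"]]
    have upt: "[m..<Suc k] = m # [Suc m..<Suc k]"
      using m by (intro upt_conv_Cons) auto
    have "?T m (chi \<gamma>) = shift_word k n lam m (\<beta> m) (?T (Suc m) (chi \<gamma>))"
      using \<gamma> unfolding upt by (simp add: compose_def chi_in_ell2 del: upt_Suc)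
    also have "\<dots> = shift_word k n lam m (\<beta> m) (\<lambda>\<delta>. ?c (Suc m) * chi (?\<gamma> (Suc m)) \<delta>)"
      using step.IH by simp
    also have "\<dots> = (\<lambda>\<delta>. ?c (Suc m) * shift_word k n lam m (\<beta> m) (chi (?\<gamma> (Suc m))) \<delta>)"
      by (rule bops_scale[OF _ chi_in_ell2[OF mem]])
        (rule polynomials_bops[OF shift_word_polynomials[OF m mwords_nth[OF \<beta> m]]])
    also have "shift_word k n lam m (\<beta> m) (chi (?\<gamma> (Suc m))) =
        (\<lambda>\<delta>. (\<Prod>j\<in>{1..<m}. pair_lam lam m j (\<beta> m) (\<gamma> j)) * chi (?\<gamma> m) \<delta>)"
    proof -
      have "(?\<gamma> (Suc m))(m := \<beta> m @ ?\<gamma> (Suc m) m) = ?\<gamma> m"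
        by auto
      moreover have "(\<Prod>j\<in>{1..<m}. pair_lam lam m j (\<beta> m) (?\<gamma> (Suc m) j)) =
          (\<Prod>j\<in>{1..<m}. pair_lam lam m j (\<beta> m) (\<gamma> j))"
        by (rule prod.cong) auto
      ultimately show ?thesis
        unfolding word by simp
    qed
    also have "(\<lambda>\<delta>. ?c (Suc m) * ((\<Prod>j\<in>{1..<m}. pair_lam lam m j (\<beta> m) (\<gamma> j)) * chi (?\<gamma> m) \<delta>)) =
        (\<lambda>\<delta>. ?c m * chi (?\<gamma> m) \<delta>)"
      using m by (simp add: prod.atLeast_Suc_atMost mult_ac)
    finally show ?case .
  qed
  from this[of 1] have "shift_mword k n lam \<beta> (chi \<gamma>) = (\<lambda>\<delta>. phase k lam \<beta> \<gamma> * chi (?\<gamma> 1) \<delta>)"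
    by (simp add: shift_mword_def phase_def)
  moreover have "?\<gamma> 1 = mconc \<beta> \<gamma>"
    using \<beta> \<gamma> by (auto simp: mconc_def mwords_def fun_eq_iff)
  ultimately show ?thesis by simp
qed

section \<open>Right shifts and the description of the Hardy space\<close>

definition right_shift :: "mword \<Rightarrow> mword oper" where
  "right_shift \<gamma> = weighted_shift W (\<lambda>\<beta>. mconc \<beta> \<gamma>) (\<lambda>\<beta>. phase k lam \<beta> \<gamma>)"

lemma
  assumes \<gamma>: "\<gamma> \<in> W"
  shows right_shift_bops: "right_shift \<gamma> \<in> bops W"
    and right_shift_norm_le: "f \<in> ell2 W \<Longrightarrow> ell2_norm W (right_shift \<gamma> f) \<le> ell2_norm W f"
    and right_shift_chi: "\<beta> \<in> W \<Longrightarrow>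
      right_shift \<gamma> (chi \<beta>) = (\<lambda>\<delta>. phase k lam \<beta> \<gamma> * chi (mconc \<beta> \<gamma>) \<delta>)"
proof -
  have maps: "(\<lambda>\<beta>. mconc \<beta> \<gamma>) ` W \<subseteq> W"
    using mconc_mwords[OF _ \<gamma>] by blast
  have w: "cmod (phase k lam \<beta> \<gamma>) \<le> 1" if "\<beta> \<in> W" for \<beta>
    by (simp add: norm_phase[OF that \<gamma>])
  show "right_shift \<gamma> \<in> bops W"
    unfolding right_shift_def by (rule weighted_shift_bops[OF inj_on_mconc maps w])
  show "ell2_norm W (right_shift \<gamma> f) \<le> ell2_norm W f" if "f \<in> ell2 W"
    unfolding right_shift_def by (rule weighted_shift_norm_le[OF inj_on_mconc maps w that])
  show "right_shift \<gamma> (chi \<beta>) = (\<lambda>\<delta>. phase k lam \<beta> \<gamma> * chi (mconc \<beta> \<gamma>) \<delta>)" if "\<beta> \<in> W"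
    unfolding right_shift_def by (rule weighted_shift_chi[OF inj_on_mconc that])
qed

text \<open>Together with \<open>right_shift_outside\<close> this lists all coordinates of a
  right-shifted family, which turns the Hardy condition into equations between matrix
  entries.\<close>

lemma right_shift_mconc:
  "\<beta> \<in> W \<Longrightarrow> f \<in> ell2 W \<Longrightarrow> right_shift \<gamma> f (mconc \<beta> \<gamma>) = phase k lam \<beta> \<gamma> * f \<beta>"
  unfolding right_shift_def by (rule weighted_shift_image[OF inj_on_mconc])

lemma right_shift_outside:
  "\<delta> \<notin> (\<lambda>\<beta>. mconc \<beta> \<gamma>) ` W \<Longrightarrow> f \<in> ell2 W \<Longrightarrow> right_shift \<gamma> f \<delta> = 0"
  unfolding right_shift_def by (rule weighted_shift_outside)

lemma right_shift_mempty:
  assumes "f \<in> ell2 W"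
  shows "right_shift mempty f = f"
proof
  fix \<delta>
  show "right_shift mempty f \<delta> = f \<delta>"
    using right_shift_mconc[OF _ assms, of \<delta> mempty] right_shift_outside[OF _ assms, of \<delta> mempty]
      ell2_outside[OF assms] by (cases "\<delta> \<in> W") auto
qed

text \<open>On \<open>chi \<beta>\<close> both orders give the same basis vector. With
  \<open>w\<close> the weight of the left shift, the scalars agree because \<open>w\<close> is
  multiplicative on \<open>mconc \<beta> \<gamma>\<close> while \<open>phase_Cons\<close> splits
  \<open>w \<gamma>\<close> off the phase.\<close>

lemma shift_right_shift_commute:
  assumes i: "i \<in> {1..k}" and s: "s \<in> {1..n i}" and \<gamma>: "\<gamma> \<in> W" and f: "f \<in> ell2 W"
  shows "shift k n lam i s (right_shift \<gamma> f) = right_shift \<gamma> (shift k n lam i s f)"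
proof -
  let ?S = "shift k n lam i s" and ?R = "right_shift \<gamma>"
  have S: "?S \<in> bops W"
    by (rule shift_bops[OF i s])
  have R: "?R \<in> bops W"
    by (rule right_shift_bops[OF \<gamma>])
  have "op_mult W ?S ?R = op_mult W ?R ?S"
  proof (rule bops_eqI[OF op_mult_bops[OF S R] op_mult_bops[OF R S]])
    fix \<beta> assume \<beta>: "\<beta> \<in> W"
    let ?w = "\<lambda>\<alpha>. \<Prod>j\<in>{1..<i}. word_lam lam i j s (\<alpha> j)"
    have \<beta>': "\<beta>(i := s # \<beta> i) \<in> W"
      by (rule mwords_Cons[OF \<beta> i s])
    have \<beta>\<gamma>: "mconc \<beta> \<gamma> \<in> W"
      by (rule mconc_mwords[OF \<beta> \<gamma>])
    have "?S (?R (chi \<beta>)) = (\<lambda>\<delta>. phase k lam \<beta> \<gamma> * ?S (chi (mconc \<beta> \<gamma>)) \<delta>)"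
      unfolding right_shift_chi[OF \<gamma> \<beta>] by (rule bops_scale[OF S chi_in_ell2[OF \<beta>\<gamma>]])
    also have "\<dots> = (\<lambda>\<delta>. phase k lam \<beta> \<gamma> * (?w (mconc \<beta> \<gamma>) *
        chi ((mconc \<beta> \<gamma>)(i := s # mconc \<beta> \<gamma> i)) \<delta>))"
      by (simp add: shift_chi[OF \<beta>\<gamma>] shift_basis_def)
    also have "(mconc \<beta> \<gamma>)(i := s # mconc \<beta> \<gamma> i) = mconc (\<beta>(i := s # \<beta> i)) \<gamma>"
      by (auto simp: mconc_def)
    also have "?w (mconc \<beta> \<gamma>) = ?w \<beta> * ?w \<gamma>"
      by (simp add: mconc_def word_lam_append prod.distrib)
    finally have SR: "?S (?R (chi \<beta>)) = (\<lambda>\<delta>. phase k lam \<beta> \<gamma> * (?w \<beta> * ?w \<gamma> *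
        chi (mconc (\<beta>(i := s # \<beta> i)) \<gamma>) \<delta>))" .
    have "?R (?S (chi \<beta>)) = (\<lambda>\<delta>. ?w \<beta> * ?R (chi (\<beta>(i := s # \<beta> i))) \<delta>)"
      unfolding shift_chi[OF \<beta>] shift_basis_def by (rule bops_scale[OF R chi_in_ell2[OF \<beta>']])
    also have "\<dots> = (\<lambda>\<delta>. ?w \<beta> * (?w \<gamma> * phase k lam \<beta> \<gamma> * chi (mconc (\<beta>(i := s # \<beta> i)) \<gamma>) \<delta>))"
      unfolding right_shift_chi[OF \<gamma> \<beta>'] phase_Cons[OF i] ..
    finally show "op_mult W ?S ?R (chi \<beta>) = op_mult W ?R ?S (chi \<beta>)"
      using SR chi_in_ell2[OF \<beta>] by (simp add: compose_def mult_ac)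
  qed
  from fun_cong[OF this, of f] f show ?thesis
    by (simp add: compose_def)
qed

lemma polynomials_right_shift_commute:
  assumes "T \<in> polynomials k n lam" "\<gamma> \<in> W" "f \<in> ell2 W"
  shows "T (right_shift \<gamma> f) = right_shift \<gamma> (T f)"
  using assms(1) unfolding polynomials_def
  by (rule op_algebra_commute[rotated 3])
    (use assms shift_bops shift_right_shift_commute in \<open>auto simp: right_shift_bops\<close>)

text \<open>Term by term, the left shift by \<open>\<beta>\<close> of \<open>chi \<gamma>\<close>
  equals the right shift by \<open>\<gamma>\<close> of \<open>chi \<beta>\<close>. The series is
  thus a bounded operator applied to the expansion of \<open>c\<close>, which also gives its
  convergence.\<close>

lemma series_chi_eq:
  assumes c: "c \<in> ell2 W" and \<gamma>: "\<gamma> \<in> W"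
  shows "series_chi k n lam c \<gamma> = right_shift \<gamma> c"
proof -
  let ?g = "\<lambda>\<beta> \<delta>. c \<beta> * shift_mword k n lam \<beta> (chi \<gamma>) \<delta>"
  note R = right_shift_bops[OF \<gamma>]
  have g: "?g \<beta> = (\<lambda>\<delta>. c \<beta> * right_shift \<gamma> (chi \<beta>) \<delta>)" if "\<beta> \<in> W" for \<beta>
    by (simp add: shift_mword_chi[OF that \<gamma>] right_shift_chi[OF \<gamma> that])
  have g_ell2: "?g \<beta> \<in> ell2 W" if "\<beta> \<in> W" for \<beta>
    unfolding g[OF that] by (intro ell2_scale bops_ell2[OF R] chi_in_ell2 that)
  have "ell2_has_sum W ?g W (right_shift \<gamma> c)"
    unfolding ell2_has_sum_def
  proof (intro conjI bops_ell2[OF R c])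
    let ?t = "\<lambda>E. ell2_norm W (\<lambda>x. if x \<in> E then 0 else c x)"
    have "\<forall>\<^sub>F E in finite_subsets_at_top W.
        norm (ell2_norm W (\<lambda>\<delta>. (\<Sum>\<beta>\<in>E. ?g \<beta> \<delta>) - right_shift \<gamma> c \<delta>)) \<le> ?t E"
    proof (rule eventually_finite_subsets_at_top_weakI)
      fix E assume E: "finite E" "E \<subseteq> W"
      have cE: "(\<lambda>x. if x \<in> E then 0 else c x) \<in> ell2 W"
        by (rule ell2_dominated[OF c]) auto
      have "(\<Sum>\<beta>\<in>E. ?g \<beta> \<delta>) = (\<Sum>\<beta>\<in>E. c \<beta> * right_shift \<gamma> (chi \<beta>) \<delta>)" for \<delta>
        by (rule sum.cong) (use E g in \<open>auto simp: fun_eq_iff subset_iff\<close>)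
      then have "ell2_norm W (\<lambda>\<delta>. (\<Sum>\<beta>\<in>E. ?g \<beta> \<delta>) - right_shift \<gamma> c \<delta>) =
          ell2_norm W (right_shift \<gamma> (\<lambda>x. if x \<in> E then 0 else c x))"
        by (simp add: bops_diff_cutoff[OF R c] bops_cutoff[OF R E] ell2_norm_minus_commute)
      also have "\<dots> \<le> ?t E"
        by (rule right_shift_norm_le[OF \<gamma> cE])
      finally show "norm (ell2_norm W (\<lambda>\<delta>. (\<Sum>\<beta>\<in>E. ?g \<beta> \<delta>) - right_shift \<gamma> c \<delta>)) \<le> ?t E"
        by simp
    qed
    from Lim_null_comparison[OF this tendsto_ell2_norm_cutoff[OF c]]
    show "((\<lambda>E. ell2_norm W (\<lambda>\<delta>. (\<Sum>\<beta>\<in>E. ?g \<beta> \<delta>) - right_shift \<gamma> c \<delta>)) \<longlongrightarrow> 0)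
        (finite_subsets_at_top W)" .
  qed
  then show ?thesis
    unfolding series_chi_def ell2_sum_def
    using ell2_has_sum_unique[where g = ?g, OF _ _ g_ell2] by (intro the_equality) auto
qed

lemma series_apply_eq:
  assumes "c \<in> ell2 W" "p \<in> ell2_span W"
  shows "series_apply k n lam c p = (\<lambda>\<delta>. \<Sum>\<gamma> | p \<gamma> \<noteq> 0. p \<gamma> * right_shift \<gamma> c \<delta>)"
  unfolding series_apply_def
  by (intro ext sum.cong) (use assms series_chi_eq in \<open>auto simp: ell2_span_def subset_iff\<close>)

text \<open>The right shift by the empty multiword is the identity, which forces \<open>c\<close> to
  be \<open>A (chi mempty)\<close>. Conversely this column is square-summable, and a bound for
  \<open>A\<close> bounds the supremum.\<close>

lemma hardy_iff:
  "A \<in> hardy k n lam \<longleftrightarrow> A \<in> bops W \<and> (\<forall>\<gamma>\<in>W. A (chi \<gamma>) = right_shift \<gamma> (A (chi mempty)))"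
proof (intro iffI conjI ballI)
  assume "A \<in> hardy k n lam"
  then obtain c where A: "A \<in> bops W" and c: "c \<in> ell2 W"
    and eq: "\<And>p. p \<in> ell2_span W \<Longrightarrow> A p = series_apply k n lam c p"
    by (auto simp: hardy_def)
  show "A \<in> bops W"
    by (rule A)
  have Achi: "A (chi \<gamma>) = right_shift \<gamma> c" if "\<gamma> \<in> W" for \<gamma>
  proof -
    have "{x. chi \<gamma> x \<noteq> 0} = {\<gamma>}"
      by (auto simp: chi_eq)
    then show ?thesis
      using eq[OF chi_ell2_span[OF that]] series_apply_eq[OF c chi_ell2_span[OF that]]
      by (simp add: chi_eq)
  qed
  then have "A (chi mempty) = c"
    using right_shift_mempty[OF c] mempty_mwords by simp
  then show "A (chi \<gamma>) = right_shift \<gamma> (A (chi mempty))" if "\<gamma> \<in> W" for \<gamma>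
    using Achi[OF that] by simp
next
  assume *: "A \<in> bops W \<and> (\<forall>\<gamma>\<in>W. A (chi \<gamma>) = right_shift \<gamma> (A (chi mempty)))"
  then have A: "A \<in> bops W"
    by blast
  let ?c = "A (chi mempty)"
  have c: "?c \<in> ell2 W"
    by (rule bops_ell2[OF A chi_in_ell2[OF mempty_mwords]])
  have eq: "A p = series_apply k n lam ?c p" if p: "p \<in> ell2_span W" for p
    unfolding bops_span[OF A p] series_apply_eq[OF c p]
    by (intro ext sum.cong) (use * p in \<open>auto simp: ell2_span_def subset_iff\<close>)
  obtain M where M: "0 \<le> M" "\<And>f. f \<in> ell2 W \<Longrightarrow> ell2_norm W (A f) \<le> M * ell2_norm W f"
    using bops_bound[OF A] by blast
  have "bdd_above {ell2_norm W (series_apply k n lam ?c p) | p.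
      p \<in> ell2_span W \<and> ell2_norm W p \<le> 1}"
  proof (rule bdd_aboveI[where M = M])
    fix r assume "r \<in> {ell2_norm W (series_apply k n lam ?c p) | p.
      p \<in> ell2_span W \<and> ell2_norm W p \<le> 1}"
    then obtain p where p: "p \<in> ell2_span W" "ell2_norm W p \<le> 1"
      and r: "r = ell2_norm W (A p)"
      using eq by auto
    have "r \<le> M * ell2_norm W p"
      unfolding r by (rule M(2)) (use p ell2_span_subset in auto)
    then show "r \<le> M"
      using mult_left_mono[OF p(2) M(1)] by simp
  qed
  then show "A \<in> hardy k n lam"
    using A c eq unfolding hardy_def by blast
qed

text \<open>Every \<open>chi \<gamma>\<close> is the right shift of \<open>chi mempty\<close>, with
  phase 1, and polynomials commute with right shifts.\<close>

lemma polynomials_subset_hardy: "polynomials k n lam \<subseteq> hardy k n lam"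
proof
  fix T assume T: "T \<in> polynomials k n lam"
  have "T (chi \<gamma>) = right_shift \<gamma> (T (chi mempty))" if \<gamma>: "\<gamma> \<in> W" for \<gamma>
    using polynomials_right_shift_commute[OF T \<gamma> chi_in_ell2[OF mempty_mwords]]
      right_shift_chi[OF \<gamma> mempty_mwords] by simp
  then show "T \<in> hardy k n lam"
    using polynomials_bops[OF T] by (simp add: hardy_iff)
qed

text \<open>Stated for any topology on \<open>bops W\<close> with continuous matrix entries, so that
  one argument covers all three.\<close>

lemma closedin_hardy:
  assumes top: "topspace \<tau> = bops W"
    and cont: "\<And>\<gamma> \<delta>. \<gamma> \<in> W \<Longrightarrow> \<delta> \<in> W \<Longrightarrow> continuous_map \<tau> euclidean (\<lambda>A. A (chi \<gamma>) \<delta>)"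
  shows "closedin \<tau> (hardy k n lam)"
proof -
  let ?E = "\<lambda>(\<gamma>, \<delta>). {A \<in> topspace \<tau>. A (chi \<gamma>) \<delta> = right_shift \<gamma> (A (chi mempty)) \<delta>}"
  have c: "A (chi \<gamma>) \<in> ell2 W" if "A \<in> topspace \<tau>" "\<gamma> \<in> W" for A \<gamma>
    using that by (intro bops_ell2[OF _ chi_in_ell2]) (simp_all add: top)
  have "closedin \<tau> (?E (\<gamma>, \<delta>))" if \<gamma>: "\<gamma> \<in> W" and \<delta>: "\<delta> \<in> W" for \<gamma> \<delta>
  proof -
    \<comment> \<open>The right-hand side of the equation is a constant multiple of one matrix entry
      if \<open>\<delta>\<close> ends in \<open>\<gamma>\<close>, and 0 otherwise.\<close>
    have "\<exists>\<phi>. continuous_map \<tau> euclidean \<phi> \<and>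
        (\<forall>A\<in>topspace \<tau>. right_shift \<gamma> (A (chi mempty)) \<delta> = \<phi> A)"
    proof (cases "\<delta> \<in> (\<lambda>\<beta>. mconc \<beta> \<gamma>) ` W")
      case True
      then obtain \<beta> where \<beta>: "\<beta> \<in> W" "\<delta> = mconc \<beta> \<gamma>"
        by blast
      have "continuous_map \<tau> euclidean ((\<lambda>z. phase k lam \<beta> \<gamma> * z) \<circ> (\<lambda>A. A (chi mempty) \<beta>))"
        by (rule continuous_map_compose[OF cont[OF mempty_mwords \<beta>(1)]])
          (auto intro: continuous_intros)
      then show ?thesis
        using right_shift_mconc[OF \<beta>(1) c[OF _ mempty_mwords]] \<beta>(2) by (auto simp: o_def)
    next
      case False
      then show ?thesis
        using right_shift_outside[OF False c[OF _ mempty_mwords]]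
        by (intro exI[of _ "\<lambda>_. 0"]) auto
    qed
    then obtain \<phi> where \<phi>: "continuous_map \<tau> euclidean \<phi>"
      "\<And>A. A \<in> topspace \<tau> \<Longrightarrow> right_shift \<gamma> (A (chi mempty)) \<delta> = \<phi> A"
      by blast
    have "closedin \<tau> {A \<in> topspace \<tau>. A (chi \<gamma>) \<delta> - \<phi> A \<in> {0}}"
      by (rule closedin_continuous_map_preimage[OF continuous_map_diff[OF cont[OF \<gamma> \<delta>] \<phi>(1)]]) simp
    also have "{A \<in> topspace \<tau>. A (chi \<gamma>) \<delta> - \<phi> A \<in> {0}} = ?E (\<gamma>, \<delta>)"
      using \<phi>(2) by auto
    finally show ?thesis .
  qed
  \<comment> \<open>The empty multiword makes the index set nonempty, as closedness of an
    intersection requires.\<close>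
  then have "closedin \<tau> (\<Inter>p\<in>W \<times> W. ?E p)"
    using mempty_mwords[of k n] by (intro closedin_INT) auto
  also have "(\<Inter>p\<in>W \<times> W. ?E p) = hardy k n lam"
  proof (intro equalityI subsetI)
    fix A assume "A \<in> (\<Inter>p\<in>W \<times> W. ?E p)"
    then have A: "A \<in> topspace \<tau>"
      and eq: "\<And>\<gamma> \<delta>. \<gamma> \<in> W \<Longrightarrow> \<delta> \<in> W \<Longrightarrow> A (chi \<gamma>) \<delta> = right_shift \<gamma> (A (chi mempty)) \<delta>"
      using mempty_mwords by fastforce+
    have "A (chi \<gamma>) = right_shift \<gamma> (A (chi mempty))" if \<gamma>: "\<gamma> \<in> W" for \<gamma>
    proof
      fix \<delta>
      show "A (chi \<gamma>) \<delta> = right_shift \<gamma> (A (chi mempty)) \<delta>"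
        using eq[OF \<gamma>, of \<delta>] ell2_outside[OF c[OF A \<gamma>]]
          ell2_outside[OF bops_ell2[OF right_shift_bops[OF \<gamma>] c[OF A mempty_mwords]]]
        by (cases "\<delta> \<in> W") simp_all
    qed
    then show "A \<in> hardy k n lam"
      using A by (simp add: hardy_iff top)
  qed (auto simp: hardy_iff top)
  finally show ?thesis .
qed

end

section \<open>Fejer means\<close>

text \<open>
  \<open>band N m\<close> is the range of the \<open>m\<close>-th block projection in the Fejer mean; every length lies in
  exactly \<open>N + 1\<close> bands.
\<close>

definition band :: "nat \<Rightarrow> nat \<Rightarrow> nat \<Rightarrow> bool" where
  "band N m l \<longleftrightarrow> l \<le> m \<and> m \<le> l + N"

lemma card_band_le: "card {m \<in> {..L}. band N m l} \<le> Suc N"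
proof -
  have "card {m \<in> {..L}. band N m l} \<le> card {l..l + N}"
    by (rule card_mono) (auto simp: band_def)
  then show ?thesis by simp
qed

text \<open>The common bands are those with \<open>m\<close> from \<open>d + l\<close> to
  \<open>l + N\<close>. This count, zero for \<open>d > N\<close>, is the numerator of the Fejer
  weight; \<open>L\<close> only has to be large enough to include them.\<close>

lemma card_band_band:
  assumes "l + N \<le> L"
  shows "card {m \<in> {..L}. band N m l \<and> band N m (d + l)} = Suc N - d"
proof -
  have "{m \<in> {..L}. band N m l \<and> band N m (d + l)} = {d + l..l + N}"
    using assms by (auto simp: band_def)
  then show ?thesis by simp
qed

text \<open>After exchanging the sums, each point is counted once per band containing its length,
  hence at most \<open>N + 1\<close> times.\<close>

lemma sum_band_squares_le:
  fixes h :: "'a \<Rightarrow> complex"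
  assumes "finite G"
  shows "L2_set (\<lambda>m. L2_set (\<lambda>x. cmod (h x)) {x \<in> G. band N m (l x)}) {..L}
    \<le> sqrt (Suc N) * L2_set (\<lambda>x. cmod (h x)) G"
proof -
  have "(\<Sum>m\<le>L. (L2_set (\<lambda>x. cmod (h x)) {x \<in> G. band N m (l x)})\<^sup>2) =
      (\<Sum>m\<le>L. \<Sum>x\<in>G. if band N m (l x) then (cmod (h x))\<^sup>2 else 0)"
    using assms by (simp add: L2_set_def sum_nonneg sum.inter_filter)
  also have "\<dots> = (\<Sum>x\<in>G. \<Sum>m\<le>L. if band N m (l x) then (cmod (h x))\<^sup>2 else 0)"
    by (rule sum.swap)
  also have "\<dots> = (\<Sum>x\<in>G. real (card {m \<in> {..L}. band N m (l x)}) * (cmod (h x))\<^sup>2)"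
    by (simp flip: sum.inter_filter)
  also have "\<dots> \<le> (\<Sum>x\<in>G. real (Suc N) * (cmod (h x))\<^sup>2)"
    by (intro sum_mono mult_right_mono) (simp_all only: of_nat_le_iff card_band_le zero_le_power2)
  finally have "sqrt (\<Sum>m\<le>L. (L2_set (\<lambda>x. cmod (h x)) {x \<in> G. band N m (l x)})\<^sup>2) \<le>
      sqrt (real (Suc N) * (\<Sum>x\<in>G. (cmod (h x))\<^sup>2))"
    by (simp only: sum_distrib_left real_sqrt_le_iff)
  then show ?thesis
    unfolding L2_set_def real_sqrt_mult .
qed

context twisted_shifts
begin

text \<open>Subtraction of naturals truncates, so the weight vanishes on lengths above
  \<open>N\<close>.\<close>

definition fejer_weight :: "nat \<Rightarrow> mword \<Rightarrow> complex" where
  "fejer_weight N \<beta> = of_nat (Suc N - mlen k \<beta>) / of_nat (Suc N)"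

text \<open>Defined through the coefficients, so that it is visibly a polynomial; the form as an
  average of compressions is derived in \<open>fejer_mean_entry\<close>.\<close>

definition fejer_mean :: "nat \<Rightarrow> mword oper \<Rightarrow> mword oper" where
  "fejer_mean N A = (\<lambda>f\<in>ell2 W. \<lambda>\<delta>. \<Sum>\<beta> | \<beta> \<in> W \<and> mlen k \<beta> \<le> N.
     (fejer_weight N \<beta> * A (chi mempty) \<beta>) * shift_mword k n lam \<beta> f \<delta>)"

lemma fejer_mean_polynomials: "fejer_mean N A \<in> polynomials k n lam"
  unfolding fejer_mean_def polynomials_def
  by (rule op_algebra_sum[OF finite_mwords_mlen_le])
    (use shift_mword_polynomials in \<open>auto simp: polynomials_def\<close>)

lemma fejer_mean_bops: "fejer_mean N A \<in> bops W"
  by (rule polynomials_bops[OF fejer_mean_polynomials])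

text \<open>The deviation from 1 is the minimum of the length and \<open>N + 1\<close>, divided by
  \<open>N + 1\<close>. The first bound provides domination, the second pointwise
  convergence.\<close>

lemma norm_fejer_weight_diff:
  "cmod (fejer_weight N \<beta> - 1) \<le> 1"
  "cmod (fejer_weight N \<beta> - 1) \<le> real (mlen k \<beta>) * inverse (real (Suc N))"
proof -
  let ?l = "mlen k \<beta>"
  have "fejer_weight N \<beta> - 1 = - of_real (real (min ?l (Suc N)) / real (Suc N))"
    by (cases "?l \<le> Suc N") (simp_all add: fejer_weight_def of_nat_diff field_simps min_def
        del: of_nat_Suc)
  then have "cmod (fejer_weight N \<beta> - 1) = real (min ?l (Suc N)) / real (Suc N)"
    by (simp del: of_real_divide of_nat_Suc)
  then show "cmod (fejer_weight N \<beta> - 1) \<le> 1"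
    "cmod (fejer_weight N \<beta> - 1) \<le> real ?l * inverse (real (Suc N))"
    by (simp_all add: divide_right_mono flip: divide_inverse del: of_nat_Suc)
qed

section \<open>Norm bound and convergence for a fixed Hardy space operator\<close>

context
  fixes A :: "mword oper" and M :: real
  assumes hardy: "A \<in> hardy k n lam" and M: "0 \<le> M"
    and bound: "\<And>f. f \<in> ell2 W \<Longrightarrow> ell2_norm W (A f) \<le> M * ell2_norm W f"
begin

lemma A_bops: "A \<in> bops W"
  using hardy by (simp add: hardy_iff)

lemma symbol_ell2: "A (chi mempty) \<in> ell2 W"
  by (rule bops_ell2[OF A_bops chi_in_ell2[OF mempty_mwords]])

lemma A_chi: "\<gamma> \<in> W \<Longrightarrow> A (chi \<gamma>) = right_shift \<gamma> (A (chi mempty))"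
  using hardy by (simp add: hardy_iff)

lemma weighted_diff_ell2: "(\<lambda>\<beta>. (fejer_weight N \<beta> - 1) * A (chi mempty) \<beta>) \<in> ell2 W"
  by (rule ell2_dominated[OF symbol_ell2])
    (simp add: norm_mult mult_left_le_one_le norm_fejer_weight_diff(1))

lemma weighted_ell2: "(\<lambda>\<beta>. fejer_weight N \<beta> * A (chi mempty) \<beta>) \<in> ell2 W"
  using ell2_add[OF weighted_diff_ell2[of N] symbol_ell2] by (simp add: algebra_simps)

text \<open>Puts the Fejer mean in the form of \<open>A_chi\<close>, with damped coefficients in
  place of those of \<open>A\<close>.\<close>

lemma fejer_mean_chi:
  assumes \<gamma>: "\<gamma> \<in> W"
  shows "fejer_mean N A (chi \<gamma>) = right_shift \<gamma> (\<lambda>\<beta>. fejer_weight N \<beta> * A (chi mempty) \<beta>)"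
proof -
  let ?F = "{\<beta>. \<beta> \<in> W \<and> mlen k \<beta> \<le> N}" and ?c = "\<lambda>\<beta>. fejer_weight N \<beta> * A (chi mempty) \<beta>"
  have "?c = (\<lambda>\<beta>. if \<beta> \<in> ?F then ?c \<beta> else 0)"
    using ell2_outside[OF symbol_ell2] by (auto simp: fejer_weight_def fun_eq_iff)
  then have "right_shift \<gamma> ?c = right_shift \<gamma> (\<lambda>\<beta>. if \<beta> \<in> ?F then ?c \<beta> else 0)"
    by (rule arg_cong)
  also have "\<dots> = (\<lambda>\<delta>. \<Sum>\<beta>\<in>?F. ?c \<beta> * right_shift \<gamma> (chi \<beta>) \<delta>)"
    by (rule bops_cutoff[OF right_shift_bops[OF \<gamma>] finite_mwords_mlen_le]) auto
  also have "\<dots> = (\<lambda>\<delta>. \<Sum>\<beta>\<in>?F. ?c \<beta> * shift_mword k n lam \<beta> (chi \<gamma>) \<delta>)"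
    by (intro ext sum.cong) (auto simp: shift_mword_chi \<gamma> right_shift_chi)
  finally show ?thesis
    by (simp add: fejer_mean_def chi_in_ell2[OF \<gamma>])
qed

text \<open>For \<open>\<delta> = mconc \<beta> \<gamma>\<close> the lengths differ by that of
  \<open>\<beta>\<close>, so the number of common bands reproduces the weight; for all other
  \<open>\<delta>\<close> both entries vanish.\<close>

lemma fejer_mean_entry:
  assumes \<gamma>: "\<gamma> \<in> W" and L: "mlen k \<gamma> + N \<le> L"
  shows "of_nat (Suc N) * fejer_mean N A (chi \<gamma>) \<delta> =
    (\<Sum>m\<le>L. if band N m (mlen k \<gamma>) \<and> band N m (mlen k \<delta>) then A (chi \<gamma>) \<delta> else 0)"
proof (cases "\<delta> \<in> (\<lambda>\<beta>. mconc \<beta> \<gamma>) ` W")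
  case True
  then obtain \<beta> where \<beta>: "\<beta> \<in> W" "\<delta> = mconc \<beta> \<gamma>"
    by blast
  have "(\<Sum>m\<le>L. if band N m (mlen k \<gamma>) \<and> band N m (mlen k \<delta>) then A (chi \<gamma>) \<delta> else 0) =
      of_nat (Suc N - mlen k \<beta>) * A (chi \<gamma>) \<delta>"
    using card_band_band[OF L, of "mlen k \<beta>"] \<beta>(2)
    by (simp add: mlen_mconc flip: sum.inter_filter)
  also have "\<dots> = of_nat (Suc N) * fejer_mean N A (chi \<gamma>) \<delta>"
    unfolding fejer_mean_chi[OF \<gamma>] A_chi[OF \<gamma>] \<beta>(2) right_shift_mconc[OF \<beta>(1) weighted_ell2]
      right_shift_mconc[OF \<beta>(1) symbol_ell2]
    by (simp add: fejer_weight_def del: of_nat_Suc)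
  finally show ?thesis ..
next
  case False
  then show ?thesis
    by (simp add: fejer_mean_chi[OF \<gamma>] A_chi[OF \<gamma>] right_shift_outside weighted_ell2 symbol_ell2
        cong: if_cong)
qed

text \<open>
  Writing \<open>P\<^sub>m\<close> for the projection onto the words whose length lies in \<open>band N m\<close>, the Fejer mean is
  \<open>(\<Sum>m. P\<^sub>m A P\<^sub>m) / (N + 1)\<close>, and \<open>\<Sum>m. \<parallel>P\<^sub>m f\<parallel>\<^sup>2 = (N + 1) \<parallel>f\<parallel>\<^sup>2\<close>; Cauchy--Schwarz then
  bounds its norm by that of \<open>A\<close>.
\<close>

lemma fejer_mean_span_norm_le:
  assumes p: "p \<in> ell2_span W"
  shows "ell2_norm W (fejer_mean N A p) \<le> M * ell2_norm W p"
proof -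
  define E where "E = {\<gamma>. p \<gamma> \<noteq> 0}"
  have E: "finite E" "E \<subseteq> W"
    using p by (auto simp: E_def ell2_span_def)
  have p_ell2: "p \<in> ell2 W"
    using p ell2_span_subset by blast
  \<comment> \<open>Large enough that \<open>{..L}\<close> contains every band meeting the support
    of \<open>p\<close>.\<close>
  define L where "L = (\<Sum>\<gamma>\<in>E. mlen k \<gamma>) + N"
  have L: "mlen k \<gamma> + N \<le> L" if "\<gamma> \<in> E" for \<gamma>
    unfolding L_def using E that by (simp add: member_le_sum)
  define g where "g = fejer_mean N A p"
  have g: "g \<in> ell2 W"
    unfolding g_def by (rule bops_ell2[OF fejer_mean_bops p_ell2])
  \<comment> \<open>The projection of \<open>p\<close> to the \<open>m\<close>-th band.\<close>
  define P where "P m = (\<lambda>\<gamma>. if \<gamma> \<in> {\<gamma> \<in> E. band N m (mlen k \<gamma>)} then p \<gamma> else 0)" for m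
  have P: "P m \<in> ell2 W" for m
    unfolding P_def by (rule ell2_cutoff[OF p_ell2])
  have P_norm: "ell2_norm W (P m) = L2_set (\<lambda>\<gamma>. cmod (p \<gamma>)) {\<gamma> \<in> E. band N m (mlen k \<gamma>)}" for m
  proof -
    have "ell2_norm W (P m) = L2_set (\<lambda>\<gamma>. cmod (P m \<gamma>)) {\<gamma> \<in> E. band N m (mlen k \<gamma>)}"
      by (rule ell2_norm_finite_support) (use E in \<open>auto simp: P_def\<close>)
    also have "\<dots> = L2_set (\<lambda>\<gamma>. cmod (p \<gamma>)) {\<gamma> \<in> E. band N m (mlen k \<gamma>)}"
      by (rule L2_set_cong) (auto simp: P_def)
    finally show ?thesis .
  qed
  have p_norm: "ell2_norm W p = L2_set (\<lambda>\<gamma>. cmod (p \<gamma>)) E"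
    by (rule ell2_norm_finite_support) (use E in \<open>auto simp: E_def\<close>)
  have AP: "A (P m) \<delta> = (\<Sum>\<gamma>\<in>E. if band N m (mlen k \<gamma>) then p \<gamma> * A (chi \<gamma>) \<delta> else 0)" for m \<delta>
  proof -
    have "A (P m) \<delta> = (\<Sum>\<gamma>\<in>{\<gamma> \<in> E. band N m (mlen k \<gamma>)}. p \<gamma> * A (chi \<gamma>) \<delta>)"
      unfolding P_def by (subst bops_cutoff[OF A_bops]) (use E in auto)
    then show ?thesis
      using E by (simp add: sum.inter_filter)
  qed
  have g_eq: "of_nat (Suc N) * g \<delta> = (\<Sum>m\<le>L. if band N m (mlen k \<delta>) then A (P m) \<delta> else 0)" for \<delta>
  proof -
    have "of_nat (Suc N) * g \<delta> = (\<Sum>\<gamma>\<in>E. p \<gamma> * (of_nat (Suc N) * fejer_mean N A (chi \<gamma>) \<delta>))"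
      unfolding g_def bops_span[OF fejer_mean_bops p] E_def[symmetric]
      by (simp only: sum_distrib_left mult.left_commute)
    also have "\<dots> = (\<Sum>\<gamma>\<in>E. p \<gamma> * (\<Sum>m\<le>L.
        if band N m (mlen k \<gamma>) \<and> band N m (mlen k \<delta>) then A (chi \<gamma>) \<delta> else 0))"
      by (rule sum.cong[OF refl]) (subst fejer_mean_entry[where L = L], use E L in auto)
    also have "\<dots> = (\<Sum>m\<le>L. \<Sum>\<gamma>\<in>E.
        p \<gamma> * (if band N m (mlen k \<gamma>) \<and> band N m (mlen k \<delta>) then A (chi \<gamma>) \<delta> else 0))"
      unfolding sum_distrib_left by (rule sum.swap)
    also have "\<dots> = (\<Sum>m\<le>L. if band N m (mlen k \<delta>) then A (P m) \<delta> else 0)"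
      unfolding AP by (intro sum.cong refl) (auto intro!: sum.cong)
    finally show ?thesis .
  qed
  have "L2_set (\<lambda>\<delta>. cmod (g \<delta>)) G \<le> M * ell2_norm W p" if G: "finite G" "G \<subseteq> W" for G
  proof -
    let ?B = "\<lambda>m. {\<delta> \<in> G. band N m (mlen k \<delta>)}" and ?a = "L2_set (\<lambda>\<delta>. cmod (g \<delta>)) G"
    let ?t = "\<lambda>m. L2_set (\<lambda>\<delta>. cmod (g \<delta>)) (?B m)"
    \<comment> \<open>The image \<open>g\<close> is tested against itself on \<open>G\<close>; one
      factor \<open>?a\<close> is cancelled at the end.\<close>
    have "real (Suc N) * ?a\<^sup>2 = (\<Sum>\<delta>\<in>G. cmod (g \<delta>) * cmod (of_nat (Suc N) * g \<delta>))"
      by (simp add: L2_set_def sum_nonneg sum_distrib_left norm_mult power2_eq_square mult_ac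
          del: of_nat_Suc)
    also have "\<dots> \<le> (\<Sum>\<delta>\<in>G. \<Sum>m\<le>L. if band N m (mlen k \<delta>) then cmod (g \<delta>) * cmod (A (P m) \<delta>) else 0)"
    proof (rule sum_mono)
      fix \<delta>
      have "cmod (of_nat (Suc N) * g \<delta>) \<le> (\<Sum>m\<le>L. cmod (if band N m (mlen k \<delta>) then A (P m) \<delta> else 0))"
        unfolding g_eq by (rule norm_sum)
      from mult_left_mono[OF this, of "cmod (g \<delta>)"]
      have "cmod (g \<delta>) * cmod (of_nat (Suc N) * g \<delta>) \<le>
          (\<Sum>m\<le>L. cmod (g \<delta>) * cmod (if band N m (mlen k \<delta>) then A (P m) \<delta> else 0))"
        by (simp add: sum_distrib_left del: of_nat_Suc)
      also have "\<dots> = (\<Sum>m\<le>L. if band N m (mlen k \<delta>) then cmod (g \<delta>) * cmod (A (P m) \<delta>) else 0)"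
        by (rule sum.cong) auto
      finally show "cmod (g \<delta>) * cmod (of_nat (Suc N) * g \<delta>) \<le>
          (\<Sum>m\<le>L. if band N m (mlen k \<delta>) then cmod (g \<delta>) * cmod (A (P m) \<delta>) else 0)" .
    qed
    also have "\<dots> = (\<Sum>m\<le>L. \<Sum>\<delta>\<in>?B m. \<bar>cmod (g \<delta>)\<bar> * \<bar>cmod (A (P m) \<delta>)\<bar>)"
      using G by (subst sum.swap) (simp add: sum.inter_filter)
    also have "\<dots> \<le> (\<Sum>m\<le>L. M * (\<bar>?t m\<bar> * \<bar>ell2_norm W (P m)\<bar>))"
    proof (rule sum_mono)
      fix m
      have "(\<Sum>\<delta>\<in>?B m. \<bar>cmod (g \<delta>)\<bar> * \<bar>cmod (A (P m) \<delta>)\<bar>) \<le>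
          ?t m * L2_set (\<lambda>\<delta>. cmod (A (P m) \<delta>)) (?B m)"
        by (rule L2_set_mult_ineq)
      also have "\<dots> \<le> ?t m * ell2_norm W (A (P m))"
        by (rule mult_left_mono[OF L2_set_le_ell2_norm[OF bops_ell2[OF A_bops P]]])
          (use G in auto)
      also have "\<dots> \<le> ?t m * (M * ell2_norm W (P m))"
        by (rule mult_left_mono[OF bound[OF P]]) simp
      finally show "(\<Sum>\<delta>\<in>?B m. \<bar>cmod (g \<delta>)\<bar> * \<bar>cmod (A (P m) \<delta>)\<bar>) \<le>
          M * (\<bar>?t m\<bar> * \<bar>ell2_norm W (P m)\<bar>)"
        by (simp add: mult_ac)
    qed
    also have "\<dots> \<le> M * (L2_set ?t {..L} * L2_set (\<lambda>m. ell2_norm W (P m)) {..L})"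
      unfolding sum_distrib_left[symmetric] by (intro mult_left_mono L2_set_mult_ineq M)
    \<comment> \<open>Each of the two families over the bands costs a factor
      \<open>sqrt (Suc N)\<close>; together they cancel the \<open>Suc N\<close> on the
      left.\<close>
    also have "\<dots> \<le> M * ((sqrt (Suc N) * ?a) * (sqrt (Suc N) * ell2_norm W p))"
      unfolding P_norm p_norm using M E G
      by (intro mult_left_mono mult_mono sum_band_squares_le) auto
    also have "\<dots> = real (Suc N) * (?a * (M * ell2_norm W p))"
      by (simp add: mult_ac flip: mult.assoc[of "sqrt _" "sqrt _"] del: of_nat_Suc)
    finally have "?a * ?a \<le> ?a * (M * ell2_norm W p)"
      by (simp add: power2_eq_square del: of_nat_Suc)
    \<comment> \<open>If \<open>?a = 0\<close> nothing can be cancelled, but the claim is then just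
      nonnegativity of the right-hand side.\<close>
    then show ?thesis
      using M L2_set_nonneg[of "\<lambda>\<delta>. cmod (g \<delta>)" G]
      by (cases "?a = 0") (auto simp: mult_le_cancel_left)
  qed
  then have "ell2_norm W g \<le> M * ell2_norm W p"
    by (intro ell2_norm_leI) (simp_all add: ell2_outside[OF g])
  then show ?thesis
    by (simp add: g_def)
qed

lemma fejer_mean_norm_le:
  "f \<in> ell2 W \<Longrightarrow> ell2_norm W (fejer_mean N A f) \<le> M * ell2_norm W f"
  by (rule bops_norm_le_from_span[OF fejer_mean_bops M fejer_mean_span_norm_le])

lemma fejer_mean_diff_norm_le:
  assumes f: "f \<in> ell2 W"
  shows "ell2_norm W (\<lambda>x. fejer_mean N A f x - A f x) \<le> 2 * M * ell2_norm W f"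
  using ell2_norm_diff_le[OF bops_ell2[OF fejer_mean_bops f] bops_ell2[OF A_bops f], of N A]
    fejer_mean_norm_le[OF f, of N] bound[OF f] by linarith

text \<open>On \<open>chi \<gamma>\<close> the error is a right shift of the coefficients of
  \<open>A\<close> multiplied by \<open>fejer_weight - 1\<close>; its norm is at most that of the
  unshifted family, which tends to 0 by dominated convergence. The bound \<open>2 * M\<close>
  carries this to all vectors.\<close>

lemma fejer_mean_tendsto:
  assumes f: "f \<in> ell2 W"
  shows "(\<lambda>N. ell2_norm W (\<lambda>x. fejer_mean N A f x - A f x)) \<longlonglongrightarrow> 0"
proof -
  define D where "D N = op_add W (fejer_mean N A) (op_scale W (-1) A)" for N
  have D: "D N \<in> bops W" for N
    unfolding D_def by (intro op_add_bops op_scale_bops fejer_mean_bops A_bops)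
  have D_apply: "D N f = (\<lambda>x. fejer_mean N A f x - A f x)" if "f \<in> ell2 W" for N f
    using that by (simp add: D_def op_add_def op_scale_def)
  let ?d = "\<lambda>N \<beta>. (fejer_weight N \<beta> - 1) * A (chi mempty) \<beta>"
  have symbol: "(\<lambda>N. ell2_norm W (?d N)) \<longlonglongrightarrow> 0"
  proof (rule ell2_dominated_convergence[OF symbol_ell2])
    show "cmod (?d N \<beta>) \<le> cmod (A (chi mempty) \<beta>)" for N \<beta>
      by (simp add: norm_mult mult_left_le_one_le norm_fejer_weight_diff(1))
    fix \<beta>
    have "(\<lambda>N. real (mlen k \<beta>) * inverse (real (Suc N))) \<longlonglongrightarrow> 0"
      by (rule tendsto_mult_right_zero[OF LIMSEQ_inverse_real_of_nat])
    then have "(\<lambda>N. fejer_weight N \<beta> - 1) \<longlonglongrightarrow> 0"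
      by (rule Lim_null_comparison[OF always_eventually[OF allI[OF norm_fejer_weight_diff(2)]]])
    then show "(\<lambda>N. ?d N \<beta>) \<longlonglongrightarrow> 0"
      by (rule tendsto_mult_left_zero)
  qed
  have "(\<lambda>N. ell2_norm W (D N f)) \<longlonglongrightarrow> 0"
  proof (rule strong_convergence_from_basis[OF D _ _ _ f])
    show "0 \<le> 2 * M"
      using M by simp
    show "ell2_norm W (D N f) \<le> 2 * M * ell2_norm W f" if "f \<in> ell2 W" for N f
      unfolding D_apply[OF that] by (rule fejer_mean_diff_norm_le[OF that])
    fix \<gamma> assume \<gamma>: "\<gamma> \<in> W"
    have "D N (chi \<gamma>) = right_shift \<gamma> (?d N)" for N
    proof -
      have "right_shift \<gamma> (?d N) =
          right_shift \<gamma> (\<lambda>\<beta>. fejer_weight N \<beta> * A (chi mempty) \<beta> - A (chi mempty) \<beta>)"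
        by (simp add: left_diff_distrib)
      then show ?thesis
        by (simp add: D_apply[OF chi_in_ell2[OF \<gamma>]] fejer_mean_chi[OF \<gamma>] A_chi[OF \<gamma>]
            bops_diff[OF right_shift_bops[OF \<gamma>] weighted_ell2 symbol_ell2])
    qed
    then have "norm (ell2_norm W (D N (chi \<gamma>))) \<le> ell2_norm W (?d N)" for N
      using right_shift_norm_le[OF \<gamma> weighted_diff_ell2] by simp
    then show "(\<lambda>N. ell2_norm W (D N (chi \<gamma>))) \<longlonglongrightarrow> 0"
      by (intro Lim_null_comparison[OF always_eventually symbol]) blast
  qed
  then show ?thesis
    by (simp add: D_apply[OF f])
qed

end

text \<open>The same sequence, the Fejer means of \<open>A\<close>, works in all three
  topologies.\<close>

lemma hardy_subset_sequential_closures: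
  "hardy k n lam \<subseteq> sequential_closure_of (SOT W) (polynomials k n lam)"
  "hardy k n lam \<subseteq> sequential_closure_of (WOT W) (polynomials k n lam)"
  "hardy k n lam \<subseteq> sequential_closure_of (weak_star W) (polynomials k n lam)"
proof -
  have lim: "limitin (SOT W) (\<lambda>N. fejer_mean N A) A sequentially \<and>
      limitin (WOT W) (\<lambda>N. fejer_mean N A) A sequentially \<and>
      limitin (weak_star W) (\<lambda>N. fejer_mean N A) A sequentially" if A: "A \<in> hardy k n lam" for A
  proof -
    have A': "A \<in> bops W"
      using A by (simp add: hardy_iff)
    obtain M where M: "0 \<le> M" "\<And>f. f \<in> ell2 W \<Longrightarrow> ell2_norm W (A f) \<le> M * ell2_norm W f"
      using bops_bound[OF A'] by blast
    note lim = fejer_mean_tendsto[OF A M]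
    show ?thesis
      using limitin_SOT[OF fejer_mean_bops A' lim] limitin_WOT[OF fejer_mean_bops A' lim]
        limitin_weak_star[OF fejer_mean_bops A' lim fejer_mean_diff_norm_le[OF A M]] by blast
  qed
  have mem: "A \<in> sequential_closure_of \<tau> (polynomials k n lam)"
    if "limitin \<tau> (\<lambda>N. fejer_mean N A) A sequentially" for \<tau> A
    unfolding sequential_closure_of_def
    by (rule CollectI, rule exI[of _ "\<lambda>N. fejer_mean N A"]) (simp add: fejer_mean_polynomials that)
  show
    "hardy k n lam \<subseteq> sequential_closure_of (SOT W) (polynomials k n lam)"
    "hardy k n lam \<subseteq> sequential_closure_of (WOT W) (polynomials k n lam)"
    "hardy k n lam \<subseteq> sequential_closure_of (weak_star W) (polynomials k n lam)"
    using mem lim by blast+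
qed

text \<open>A circle of inclusions: the Hardy space lies in the sequential closure, this in the
  closure, and the closure in the Hardy space, a closed set containing the polynomials.\<close>

lemma closures_eq_hardy:
  assumes closed: "closedin \<tau> (hardy k n lam)"
    and seq: "hardy k n lam \<subseteq> sequential_closure_of \<tau> (polynomials k n lam)"
  shows "hardy k n lam = \<tau> closure_of polynomials k n lam"
    and "hardy k n lam = sequential_closure_of \<tau> (polynomials k n lam)"
proof -
  have "\<tau> closure_of polynomials k n lam \<subseteq> hardy k n lam"
    by (rule closure_of_minimal[OF polynomials_subset_hardy closed])
  then show "hardy k n lam = \<tau> closure_of polynomials k n lam"
    "hardy k n lam = sequential_closure_of \<tau> (polynomials k n lam)"
    using seq sequential_closure_subset_closure_of[of \<tau> "polynomials k n lam"] by auto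
qed

end

theorem theorem2p1:
  fixes k :: nat and n :: "nat \<Rightarrow> nat" and lam :: "nat \<Rightarrow> nat \<Rightarrow> nat \<Rightarrow> nat \<Rightarrow> complex"
  assumes "k \<ge> 1"
    and "\<And>i. i \<in> {1..k} \<Longrightarrow> n i \<ge> 1"
    and "\<And>i j s t. i \<in> {1..k} \<Longrightarrow> j \<in> {1..k} \<Longrightarrow> i \<noteq> j \<Longrightarrow> s \<in> {1..n i} \<Longrightarrow> t \<in> {1..n j} \<Longrightarrow>
           cmod (lam i j s t) = 1"
    and "\<And>i j s t. i \<in> {1..k} \<Longrightarrow> j \<in> {1..k} \<Longrightarrow> i \<noteq> j \<Longrightarrow> s \<in> {1..n i} \<Longrightarrow> t \<in> {1..n j} \<Longrightarrow>
           lam j i t s = cnj (lam i j s t)"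
  shows "closedin (WOT (mwords k n)) (hardy k n lam) \<and>
         closedin (SOT (mwords k n)) (hardy k n lam) \<and>
         closedin (weak_star (mwords k n)) (hardy k n lam) \<and>
         hardy k n lam = SOT (mwords k n) closure_of polynomials k n lam \<and>
         hardy k n lam = WOT (mwords k n) closure_of polynomials k n lam \<and>
         hardy k n lam = weak_star (mwords k n) closure_of polynomials k n lam \<and>
         hardy k n lam = sequential_closure_of (SOT (mwords k n)) (polynomials k n lam) \<and>
         hardy k n lam = sequential_closure_of (WOT (mwords k n)) (polynomials k n lam) \<and>
         hardy k n lam = sequential_closure_of (weak_star (mwords k n)) (polynomials k n lam)"
proof -
  interpret twisted_shifts k n lam
    by unfold_locales (rule assms(3); simp)
  have WOT: "closedin (WOT W) (hardy k n lam)"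
    by (rule closedin_hardy[OF topspace_WOT continuous_map_WOT_entry])
  have SOT: "closedin (SOT W) (hardy k n lam)"
    by (rule closedin_hardy[OF topspace_SOT continuous_map_SOT_entry])
  have weak_star: "closedin (weak_star W) (hardy k n lam)"
    by (rule closedin_hardy[OF topspace_weak_star continuous_map_weak_star_entry])
  show ?thesis
    by (intro conjI WOT SOT weak_star closures_eq_hardy hardy_subset_sequential_closures)
qed

end
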